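(* Let $r\ge 2$ and $n\ge 1$ be integers. Let $T=\mathbb C^2$, let $\mathfrak g_n=\mathfrak{sl}_2[z]/z^n\mathfrak{sl}_2[z]$ be the truncated current Lie algebra, and let $\mathfrak g_n$ act on $\mathcal V_n=\mathrm{Hom}(\mathbb C^r,T\otimes\mathbb C[z]/(z^n))$ through its natural action on $T\otimes \mathbb C[z]/(z^n)$. Then $$\mathrm{mod}(\mathfrak g_n:\mathcal V_n)=(2r-3)n .$$
   Context: Everything is over $\mathbb C$. The natural action of $\mathfrak g_n=\mathfrak{sl}_2\otimes\mathbb C[z]/(z^n)$ on $T\otimes\mathbb C[z]/(z^n)$ is the $\mathbb C[z]/(z^n)$-bilinear extension of the vector representation of $\mathfrak{sl}_2$ on $T=\mathbb C^2$; on $\mathcal V_n$ it is $(\xi x)(w)=\xi(x(w))$. Modality: for a Lie algebra $\mathfrak g$ of an algebraic group acting linearly on a finite-dimensional vector space $\mathcal V$, put $\mathfrak g^x=\{\xi\in\mathfrak g\mid \xi x=0\}$ and $\mathcal V^{(\mathfrak g,s)}=\{x\in\mathcal V\mid\dim\mathfrak g^x=s\}$ (a locally closed subvariety). Then $$\mathrm{mod}(\mathfrak g:\mathcal V)=\max_{s\in\mathbb Z}\bigl(\dim\mathcal V^{(\mathfrak g,s)}-\dim\mathfrak g+s\bigr),$$ with $\dim\emptyset=-\infty$. *)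

theory Defs
  imports
    "HOL-Analysis.Analysis"
    "HOL-Library.Function_Algebras"
    "HOL-Computational_Algebra.Polynomial"
begin

section \<open>The Zariski topology of a finite-dimensional complex vector space\<close>

text \<open>Below, a vector space is a subspace \<open>V\<close> of an ambient type with scalar multiplication \<open>s\<close>.
  Values of functions outside \<open>V\<close> are irrelevant.\<close>

definition linear_functional_on ::
    "(complex \<Rightarrow> 'v \<Rightarrow> 'v) \<Rightarrow> 'v set \<Rightarrow> ('v::ab_group_add \<Rightarrow> complex) \<Rightarrow> bool" where
  "linear_functional_on s V f \<longleftrightarrow>
     (\<forall>x\<in>V. \<forall>y\<in>V. f (x + y) = f x + f y) \<and> (\<forall>c. \<forall>x\<in>V. f (s c x) = c * f x)"

inductive poly_function_on ::
    "(complex \<Rightarrow> 'v \<Rightarrow> 'v) \<Rightarrow> 'v set \<Rightarrow> ('v::ab_group_add \<Rightarrow> complex) \<Rightarrow> bool"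
  for s :: "complex \<Rightarrow> 'v \<Rightarrow> 'v" and V :: "'v set" where
  linear: "linear_functional_on s V f \<Longrightarrow> poly_function_on s V f"
| const: "poly_function_on s V (\<lambda>x. c)"
| add: "poly_function_on s V f \<Longrightarrow> poly_function_on s V g \<Longrightarrow> poly_function_on s V (\<lambda>x. f x + g x)"
| mult: "poly_function_on s V f \<Longrightarrow> poly_function_on s V g \<Longrightarrow> poly_function_on s V (\<lambda>x. f x * g x)"

definition zariski_topology ::
    "(complex \<Rightarrow> 'v \<Rightarrow> 'v) \<Rightarrow> 'v set \<Rightarrow> ('v::ab_group_add) topology" where
  "zariski_topology s V = topology (\<lambda>U. \<exists>F. (\<forall>f\<in>F. poly_function_on s V f) \<and>
     U = V - {x\<in>V. \<forall>f\<in>F. f x = 0})"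

lemma istopology_zariski:
  "istopology (\<lambda>U. \<exists>F. (\<forall>f\<in>F. poly_function_on s V f) \<and> U = V - {x\<in>V. \<forall>f\<in>F. f x = 0})"
  (is "istopology ?open")
  unfolding istopology_def
proof (intro conjI allI impI)
  fix S T assume "?open S" "?open T"
  obtain F where F: "\<forall>f\<in>F. poly_function_on s V f" and S: "S = V - {x\<in>V. \<forall>f\<in>F. f x = 0}"
    using \<open>?open S\<close> by (elim exE conjE)
  obtain G where G: "\<forall>g\<in>G. poly_function_on s V g" and T: "T = V - {x\<in>V. \<forall>g\<in>G. g x = 0}"
    using \<open>?open T\<close> by (elim exE conjE)
  let ?P = "{\<lambda>x. f x * g x | f g. f \<in> F \<and> g \<in> G}"
  have "\<forall>h\<in>?P. poly_function_on s V h"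
    using F G by (auto intro: poly_function_on.mult)
  moreover have "S \<inter> T = V - {x\<in>V. \<forall>h\<in>?P. h x = 0}"
  proof (intro set_eqI iffI)
    fix x assume "x \<in> S \<inter> T"
    then obtain f g where "x \<in> V" "f \<in> F" "g \<in> G" "f x \<noteq> 0" "g x \<noteq> 0"
      unfolding S T by blast
    moreover from this have "(\<lambda>x. f x * g x) \<in> ?P" by blast
    ultimately show "x \<in> V - {x\<in>V. \<forall>h\<in>?P. h x = 0}"
      by force
  qed (auto simp: S T)
  ultimately show "?open (S \<inter> T)"
    by (intro exI[of _ ?P] conjI)
next
  fix K assume K: "\<forall>U\<in>K. ?open U"
  let ?F = "{f. poly_function_on s V f \<and> {x\<in>V. f x \<noteq> 0} \<subseteq> \<Union>K}"
  have "\<Union>K = V - {x\<in>V. \<forall>f\<in>?F. f x = 0}"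
  proof (intro set_eqI iffI)
    fix x assume "x \<in> \<Union>K"
    then obtain U where U: "x \<in> U" "U \<in> K" by blast
    with K obtain F where F: "\<forall>f\<in>F. poly_function_on s V f" "U = V - {x\<in>V. \<forall>f\<in>F. f x = 0}"
      by meson
    with U obtain f where f: "x \<in> V" "f \<in> F" "f x \<noteq> 0" by auto
    moreover from f F(2) have "{x\<in>V. f x \<noteq> 0} \<subseteq> U" by auto
    ultimately have "f \<in> ?F" using F(1) U(2) by auto
    with f show "x \<in> V - {x\<in>V. \<forall>f\<in>?F. f x = 0}" by auto
  qed auto
  then show "?open (\<Union>K)"
    by (intro exI[of _ ?F]) simp
qed

lemma openin_zariski:
  "openin (zariski_topology s V) U \<longleftrightarrow>
     (\<exists>F. (\<forall>f\<in>F. poly_function_on s V f) \<and> U = V - {x\<in>V. \<forall>f\<in>F. f x = 0})"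
  unfolding zariski_topology_def by (simp add: topology_inverse'[OF istopology_zariski])

lemma topspace_zariski [simp]: "topspace (zariski_topology s V) = V"
proof
  show "topspace (zariski_topology s V) \<subseteq> V"
    using openin_topspace[of "zariski_topology s V"] unfolding openin_zariski by blast
  have "openin (zariski_topology s V) V"
    unfolding openin_zariski
    by (rule exI[of _ "{\<lambda>x. 1}"]) (auto intro: poly_function_on.const)
  then show "V \<subseteq> topspace (zariski_topology s V)"
    by (rule openin_subset)
qed

lemma closedin_zariski:
  "closedin (zariski_topology s V) Z \<longleftrightarrow>
     (\<exists>F. (\<forall>f\<in>F. poly_function_on s V f) \<and> Z = {x\<in>V. \<forall>f\<in>F. f x = 0})"
proof -
  have eq: "Z \<subseteq> V \<and> V - Z = V - {x\<in>V. P x} \<longleftrightarrow> Z = {x\<in>V. P x}" for P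
    by auto
  have "closedin (zariski_topology s V) Z \<longleftrightarrow>
     (\<exists>F. (\<forall>f\<in>F. poly_function_on s V f) \<and> (Z \<subseteq> V \<and> V - Z = V - {x\<in>V. \<forall>f\<in>F. f x = 0}))"
    unfolding closedin_def topspace_zariski openin_zariski by iprover
  then show ?thesis
    unfolding eq .
qed


section \<open>Krull dimension\<close>

definition irreducible_closedin :: "'a topology \<Rightarrow> 'a set \<Rightarrow> bool" where
  "irreducible_closedin X Z \<longleftrightarrow> closedin X Z \<and> Z \<noteq> {} \<and>
     (\<forall>A B. closedin X A \<longrightarrow> closedin X B \<longrightarrow> Z = A \<union> B \<longrightarrow> Z = A \<or> Z = B)"

text \<open>As \<open>Sup {} = -\<infinity>\<close> in the extended reals, the empty space has dimension \<open>-\<infinity>\<close>.\<close>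

definition krull_dim :: "'a topology \<Rightarrow> ereal" where
  "krull_dim X = Sup {ereal (real d) | d. \<exists>Z :: nat \<Rightarrow> 'a set.
     (\<forall>i\<le>d. irreducible_closedin X (Z i)) \<and> (\<forall>i<d. Z i \<subset> Z (Suc i))}"


section \<open>Modality of a linear action\<close>

definition annihilator :: "'g set \<Rightarrow> ('g \<Rightarrow> 'v \<Rightarrow> 'v::zero) \<Rightarrow> 'v \<Rightarrow> 'g set" where
  "annihilator \<gg> act x = {\<xi>\<in>\<gg>. act \<xi> x = 0}"

definition annihilator_stratum ::
    "(complex \<Rightarrow> 'g \<Rightarrow> 'g) \<Rightarrow> ('g::ab_group_add) set \<Rightarrow> 'v set \<Rightarrow> ('g \<Rightarrow> 'v \<Rightarrow> 'v::zero) \<Rightarrow>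
     int \<Rightarrow> 'v set" where
  "annihilator_stratum sg \<gg> V act k =
     {x\<in>V. int (vector_space.dim sg (annihilator \<gg> act x)) = k}"

text \<open>Here \<open>sg\<close> and \<open>sv\<close> are the scalar multiplications of the Lie algebra \<open>\<gg>\<close> and of the
  module \<open>V\<close>. For finite-dimensional \<open>\<gg>\<close> the set whose maximum is taken is finite, since all but
  finitely many strata are empty and contribute \<open>-\<infinity>\<close>.\<close>

definition modality ::
    "(complex \<Rightarrow> 'g \<Rightarrow> 'g) \<Rightarrow> ('g::ab_group_add) set \<Rightarrow>
     (complex \<Rightarrow> 'v \<Rightarrow> 'v) \<Rightarrow> 'v set \<Rightarrow> ('g \<Rightarrow> 'v \<Rightarrow> 'v::ab_group_add) \<Rightarrow> ereal" where
  "modality sg \<gg> sv V act = Max (range (\<lambda>k::int.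
     krull_dim (subtopology (zariski_topology sv V) (annihilator_stratum sg \<gg> V act k))
       - ereal (real (vector_space.dim sg \<gg>)) + ereal (of_int k)))"


section \<open>Truncated currents\<close>

text \<open>\<open>\<complex>[z]/(z\<^sup>n)\<close> is represented by the remainders modulo \<open>z\<^sup>n\<close>, with the product
  \<open>(p * q) mod z\<^sup>n\<close>; \<open>T \<otimes> \<complex>[z]/(z\<^sup>n)\<close> by pairs, and \<open>\<ss>\<ll>\<^sub>2[z]/z\<^sup>n\<ss>\<ll>\<^sub>2[z]\<close> by
  traceless \<open>2 \<times> 2\<close> matrices, of such remainders.\<close>

definition trunc :: "nat \<Rightarrow> complex poly \<Rightarrow> complex poly" where
  "trunc n p = p mod monom 1 n"

definition trunc_vec :: "nat \<Rightarrow> complex poly^2 \<Rightarrow> complex poly^2" where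
  "trunc_vec n v = (\<chi> i. trunc n (v $ i))"

definition trunc_mat :: "nat \<Rightarrow> complex poly^2^2 \<Rightarrow> complex poly^2^2" where
  "trunc_mat n A = (\<chi> i j. trunc n (A $ i $ j))"

definition current_vec :: "nat \<Rightarrow> (complex poly^2) set" where
  "current_vec n = {v. trunc_vec n v = v}"

definition current_sl2 :: "nat \<Rightarrow> (complex poly^2^2) set" where
  "current_sl2 n = {A. trunc_mat n A = A \<and> trace A = 0}"

definition current_bracket :: "nat \<Rightarrow> complex poly^2^2 \<Rightarrow> complex poly^2^2 \<Rightarrow> complex poly^2^2" where
  "current_bracket n A B = trunc_mat n (A ** B - B ** A)"

definition current_act :: "nat \<Rightarrow> complex poly^2^2 \<Rightarrow> complex poly^2 \<Rightarrow> complex poly^2" where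
  "current_act n A v = trunc_vec n (A *v v)"

definition scale_vec :: "complex \<Rightarrow> complex poly^2 \<Rightarrow> complex poly^2" where
  "scale_vec c v = (\<chi> i. smult c (v $ i))"

definition scale_mat :: "complex \<Rightarrow> complex poly^2^2 \<Rightarrow> complex poly^2^2" where
  "scale_mat c A = (\<chi> i j. smult c (A $ i $ j))"

definition hom_current :: "nat \<Rightarrow> (complex^'r \<Rightarrow> complex poly^2) set" where
  "hom_current n = {x. Vector_Spaces.linear (*s) scale_vec x \<and> range x \<subseteq> current_vec n}"

definition hom_scale ::
    "complex \<Rightarrow> (complex^'r \<Rightarrow> complex poly^2) \<Rightarrow> (complex^'r \<Rightarrow> complex poly^2)" where
  "hom_scale c x = (\<lambda>w. scale_vec c (x w))"

definition hom_act ::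
    "nat \<Rightarrow> complex poly^2^2 \<Rightarrow> (complex^'r \<Rightarrow> complex poly^2) \<Rightarrow> (complex^'r \<Rightarrow> complex poly^2)" where
  "hom_act n A x = (\<lambda>w. current_act n A (x w))"

lemma vector_space_scale_vec: "vector_space scale_vec"
  by unfold_locales (simp_all add: scale_vec_def vec_eq_iff smult_add_right smult_add_left)

lemma vector_space_scale_mat: "vector_space scale_mat"
  by unfold_locales (simp_all add: scale_mat_def vec_eq_iff smult_add_right smult_add_left)

lemma vector_space_hom_scale: "vector_space hom_scale"
  by unfold_locales
    (simp_all add: hom_scale_def scale_vec_def fun_eq_iff vec_eq_iff smult_add_right smult_add_left)

interpretation scale_vec: vector_space scale_vec by (rule vector_space_scale_vec)
interpretation scale_mat: vector_space scale_mat by (rule vector_space_scale_mat)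
interpretation hom_scale: vector_space hom_scale by (rule vector_space_hom_scale)

lemma trunc_add: "trunc n (p + q) = trunc n p + trunc n q"
  and trunc_diff: "trunc n (p - q) = trunc n p - trunc n q"
  and trunc_smult: "trunc n (smult c p) = smult c (trunc n p)"
  and trunc_0 [simp]: "trunc n 0 = 0"
  and trunc_trunc [simp]: "trunc n (trunc n p) = trunc n p"
  and trunc_mult_left: "trunc n (trunc n p * q) = trunc n (p * q)"
  and trunc_mult_right: "trunc n (p * trunc n q) = trunc n (p * q)"
  by (simp_all add: trunc_def poly_mod_add_left poly_mod_diff_left mod_smult_left mod_simps)

lemma subspace_current_sl2: "scale_mat.subspace (current_sl2 n)"
  unfolding scale_mat.subspace_def
proof (intro conjI ballI allI)
  show "0 \<in> current_sl2 n"
    by (simp add: current_sl2_def trunc_mat_def trace_def vec_eq_iff)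
next
  fix A B assume "A \<in> current_sl2 n" "B \<in> current_sl2 n"
  then show "A + B \<in> current_sl2 n"
    by (simp add: current_sl2_def trunc_mat_def trace_add vec_eq_iff trunc_add)
next
  fix c A assume A: "A \<in> current_sl2 n"
  have "trace (scale_mat c A) = smult c (trace A)"
    by (simp add: trace_def scale_mat_def sum_2 smult_add_right)
  with A show "scale_mat c A \<in> current_sl2 n"
    by (simp add: current_sl2_def trunc_mat_def scale_mat_def vec_eq_iff trunc_smult)
qed

lemma subspace_current_vec: "scale_vec.subspace (current_vec n)"
  by (auto simp: scale_vec.subspace_def current_vec_def trunc_vec_def scale_vec_def
      vec_eq_iff trunc_add trunc_smult)

lemma linear_hom_iff:
  "Vector_Spaces.linear (*s) scale_vec x \<longleftrightarrow>
     (\<forall>v w. x (v + w) = x v + x w) \<and> (\<forall>c v. x (c *s v) = scale_vec c (x v))"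
  by (intro iffI) (auto simp: Vector_Spaces.linear_iff vec.vector_space_axioms
      vector_space_scale_vec)

lemma subspace_hom_current: "hom_scale.subspace (hom_current n)"
  using subspace_current_vec[of n]
  by (auto simp: hom_scale.subspace_def hom_current_def linear_hom_iff hom_scale_def
      scale_vec.subspace_def scale_vec.scale_right_distrib mult.commute image_subset_iff)

lemma current_bracket_in:
  "current_bracket n A B \<in> current_sl2 n"
proof -
  have "trace (current_bracket n A B) = trunc n (trace (A ** B - B ** A))"
    by (simp add: trace_def current_bracket_def trunc_mat_def sum_2 trunc_add)
  also have "\<dots> = 0"
    by (simp add: trace_sub trace_mul_sym[of A B])
  finally show ?thesis
    by (simp add: current_sl2_def current_bracket_def trunc_mat_def vec_eq_iff)
qed

lemma trunc_matrix_vector: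
  "trunc_vec n (trunc_mat n A *v v) = trunc_vec n (A *v v)"
  "trunc_vec n (A *v trunc_vec n v) = trunc_vec n (A *v v)"
  by (simp_all add: trunc_vec_def trunc_mat_def vec_eq_iff matrix_vector_mult_def sum_2
      trunc_add trunc_mult_left trunc_mult_right)

lemma trunc_vec_diff: "trunc_vec n (v - w) = trunc_vec n v - trunc_vec n w"
  by (simp add: trunc_vec_def vec_eq_iff trunc_diff)

lemma hom_act_bracket:
  "hom_act n (current_bracket n A B) x = hom_act n A (hom_act n B x) - hom_act n B (hom_act n A x)"
  by (simp add: fun_eq_iff hom_act_def current_act_def current_bracket_def trunc_matrix_vector
      matrix_vector_mult_diff_rdistrib matrix_vector_mul_assoc trunc_vec_diff)

lemma hom_act_in:
  assumes "x \<in> hom_current n"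
  shows "hom_act n A x \<in> hom_current n"
proof -
  have x: "x (v + w) = x v + x w" "x (c *s v) = scale_vec c (x v)" for v w c
    using assms by (auto simp: hom_current_def linear_hom_iff)
  have "current_act n A (u + v) = current_act n A u + current_act n A v" for u v
    by (simp add: current_act_def matrix_vector_right_distrib trunc_vec_def vec_eq_iff trunc_add)
  moreover have "current_act n A (scale_vec c u) = scale_vec c (current_act n A u)" for c u
    by (simp add: current_act_def matrix_vector_mult_def scale_vec_def trunc_vec_def vec_eq_iff
        sum_2 trunc_add trunc_smult smult_add_right)
  moreover have "current_act n A u \<in> current_vec n" for u
    by (simp add: current_act_def current_vec_def trunc_vec_def vec_eq_iff)
  ultimately show ?thesis
    by (auto simp: hom_current_def linear_hom_iff hom_act_def x)
qed

end

theory Submission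
  imports Defs
begin

text \<open>A module element \<open>x\<close> is a \<open>2 \<times> r\<close> matrix over \<open>\<complex>[z]/(z\<^sup>n)\<close>; if its invariant factors are \<open>z\<^sup>a\<close>
  and \<open>z\<^sup>b\<close>, its annihilator has dimension at most \<open>2a + b\<close>. The matrices with these invariants are
  covered by polynomial images of an affine space of dimension \<open>(r + 1)(n - a) + (r - 1)(n - b)\<close>,
  which is at most \<open>2rn - (2a + b)\<close> since \<open>r \<ge> 2\<close>. So the stratum of annihilator dimension \<open>k\<close> has
  dimension at most \<open>2rn - k\<close> and contributes at most \<open>2rn - 3n\<close>. Equality holds for \<open>k = 0\<close>, as this
  stratum contains the nonempty open set where a fixed \<open>2 \<times> 2\<close> minor is a unit.

  Dimension theory is reduced to counting: a chain of \<open>d + 1\<close> irreducible closed sets in a stratum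
  yields \<open>d\<close> polynomial functions that are algebraically independent on it, whereas on a finite union
  of polynomial images of affine \<open>e\<close>-space any \<open>e + 1\<close> polynomial functions are dependent, because
  their monomials outnumber the monomials in the parameters.\<close>


section \<open>Irreducible chains and algebraic independence\<close>

lemma poly_function_on_power:
  assumes "poly_function_on s V f"
  shows "poly_function_on s V (\<lambda>x. f x ^ k)"
  by (induction k) (auto intro: poly_function_on.intros assms)

lemma poly_function_on_sum:
  assumes "\<And>i. i \<in> A \<Longrightarrow> poly_function_on s V (f i)"
  shows "poly_function_on s V (\<lambda>x. \<Sum>i\<in>A. f i x)"
  using assms by (induction A rule: infinite_finite_induct) (auto intro: poly_function_on.intros)

lemma poly_function_on_prod:
  assumes "\<And>i. i \<in> A \<Longrightarrow> poly_function_on s V (f i)"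
  shows "poly_function_on s V (\<lambda>x. \<Prod>i\<in>A. f i x)"
  using assms by (induction A rule: infinite_finite_induct) (auto intro: poly_function_on.intros)

section \<open>Relatively closed subsets of a stratum and irreducibility\<close>

lemma closedin_subtopology_zariski:
  "closedin (subtopology (zariski_topology s V) S) Z \<longleftrightarrow>
     (\<exists>F. (\<forall>f\<in>F. poly_function_on s V f) \<and> Z = {x\<in>V \<inter> S. \<forall>f\<in>F. f x = 0})"
proof -
  have eq: "{x\<in>V. \<forall>f\<in>F. f x = 0} \<inter> S = {x\<in>V \<inter> S. \<forall>f\<in>F. f x = 0}" for F :: "('a \<Rightarrow> complex) set"
    by auto
  then show ?thesis
    unfolding closedin_subtopology closedin_zariski eq[symmetric] by blast
qed

lemma closedin_subtopology_zariski_zeros: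
  assumes "poly_function_on s V f"
  shows "closedin (subtopology (zariski_topology s V) S) {x\<in>V \<inter> S. f x = 0}"
  unfolding closedin_subtopology_zariski using assms by (intro exI[of _ "{f}"]) auto

text \<open>\<open>Z\<close> is covered by the closed zero sets of \<open>f\<close> and of
  \<open>g\<close>, so irreducibility puts it inside one of them: the vanishing ideal of
  \<open>Z\<close> is prime.\<close>

lemma irreducible_closedin_mult_zero:
  assumes irr: "irreducible_closedin (subtopology (zariski_topology s V) S) Z"
    and f: "poly_function_on s V f" and g: "poly_function_on s V g"
    and zero: "\<And>x. x \<in> Z \<Longrightarrow> f x * g x = 0"
  shows "(\<forall>x\<in>Z. f x = 0) \<or> (\<forall>x\<in>Z. g x = 0)"
proof -
  let ?X = "subtopology (zariski_topology s V) S"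
  have Z: "closedin ?X Z" and prime: "\<And>A B. \<lbrakk>closedin ?X A; closedin ?X B; Z = A \<union> B\<rbrakk> \<Longrightarrow> Z = A \<or> Z = B"
    using irr unfolding irreducible_closedin_def by auto
  have sub: "Z \<subseteq> V \<inter> S"
    using closedin_subset[OF Z] by simp
  have "Z = Z \<inter> {x\<in>V \<inter> S. f x = 0} \<or> Z = Z \<inter> {x\<in>V \<inter> S. g x = 0}"
    using sub zero
    by (intro prime closedin_Int Z closedin_subtopology_zariski_zeros f g) fastforce
  then show ?thesis by blast
qed

text \<open>Relations are written with all exponents below a common \<open>N\<close>, so that they
  have exactly \<open>N ^ m\<close> coefficients; this makes the later counting argument
  immediate.\<close>

definition alg_indep_on :: "'v set \<Rightarrow> (nat \<Rightarrow> 'v \<Rightarrow> complex) \<Rightarrow> nat \<Rightarrow> bool" where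
  "alg_indep_on Z f m \<longleftrightarrow> (\<forall>N c.
     (\<forall>x\<in>Z. (\<Sum>\<alpha>\<in>{..<m} \<rightarrow>\<^sub>E {..<N}. c \<alpha> * (\<Prod>i<m. f i x ^ \<alpha> i)) = 0) \<longrightarrow>
     (\<forall>\<alpha>\<in>{..<m} \<rightarrow>\<^sub>E {..<N}. c \<alpha> = 0))"

lemma alg_indep_on_mono: "alg_indep_on Z f m \<Longrightarrow> Z \<subseteq> S \<Longrightarrow> alg_indep_on S f m"
  unfolding alg_indep_on_def by blast

lemma alg_indep_on_0: "Z \<noteq> {} \<Longrightarrow> alg_indep_on Z f 0"
  unfolding alg_indep_on_def by auto

lemma sum_PiE_lessThan_Suc:
  fixes F :: "(nat \<Rightarrow> 'b) \<Rightarrow> 'c::comm_monoid_add"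
  shows "(\<Sum>\<alpha>\<in>{..<Suc m} \<rightarrow>\<^sub>E A. F \<alpha>) = (\<Sum>j\<in>A. \<Sum>\<alpha>\<in>{..<m} \<rightarrow>\<^sub>E A. F (\<alpha>(m := j)))"
proof -
  have "(\<Sum>\<alpha>\<in>{..<Suc m} \<rightarrow>\<^sub>E A. F \<alpha>)
    = (\<Sum>\<alpha>\<in>(\<lambda>(j, \<alpha>). \<alpha>(m := j)) ` (A \<times> ({..<m} \<rightarrow>\<^sub>E A)). F \<alpha>)"
    by (simp add: lessThan_Suc PiE_insert_eq)
  also have "\<dots> = (\<Sum>(j, \<alpha>)\<in>A \<times> ({..<m} \<rightarrow>\<^sub>E A). F (\<alpha>(m := j)))"
    by (subst sum.reindex[OF inj_combinator]) (auto simp: case_prod_unfold)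
  finally show ?thesis
    by (simp add: sum.cartesian_product)
qed

text \<open>A relation on \<open>Z'\<close> is read as a polynomial in \<open>f m\<close> with
  coefficients \<open>Q j\<close>. Its lowest remaining power of \<open>f m\<close> can be cancelled
  by irreducibility, since \<open>f m\<close> is nonzero at \<open>p\<close>. Restricting to
  \<open>Z\<close>, where \<open>f m\<close> vanishes, isolates the lowest coefficient, and
  independence on \<open>Z\<close> kills it.\<close>

lemma alg_indep_on_Suc:
  assumes indep: "alg_indep_on Z f m"
    and irr: "irreducible_closedin (subtopology (zariski_topology s V) S) Z'"
    and poly: "\<And>i. i \<le> m \<Longrightarrow> poly_function_on s V (f i)"
    and sub: "Z \<subseteq> Z'"
    and zero: "\<And>x. x \<in> Z \<Longrightarrow> f m x = 0"
    and p: "p \<in> Z'" "f m p \<noteq> 0"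
  shows "alg_indep_on Z' f (Suc m)"
  unfolding alg_indep_on_def
proof (intro allI impI)
  fix N and c :: "(nat \<Rightarrow> nat) \<Rightarrow> complex"
  assume rel: "\<forall>x\<in>Z'. (\<Sum>\<alpha>\<in>{..<Suc m} \<rightarrow>\<^sub>E {..<N}. c \<alpha> * (\<Prod>i<Suc m. f i x ^ \<alpha> i)) = 0"
  define Q where "Q j x = (\<Sum>\<alpha>\<in>{..<m} \<rightarrow>\<^sub>E {..<N}. c (\<alpha>(m := j)) * (\<Prod>i<m. f i x ^ \<alpha> i))" for j x
  have Qpoly: "poly_function_on s V (Q j)" for j
    unfolding Q_def using poly
    by (intro poly_function_on_sum poly_function_on.mult poly_function_on.const
        poly_function_on_prod poly_function_on_power) auto
  have rel': "(\<Sum>j<N. Q j x * f m x ^ j) = 0" if "x \<in> Z'" for x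
    using rel that by (simp add: sum_PiE_lessThan_Suc Q_def sum_distrib_right mult.assoc)
  have zeros: "j < N \<longrightarrow> (\<forall>\<alpha>\<in>{..<m} \<rightarrow>\<^sub>E {..<N}. c (\<alpha>(m := j)) = 0)" for j
  proof (induction j rule: less_induct)
    case (less j)
    show ?case
    proof
      assume j: "j < N"
      \<comment> \<open>By induction all coefficients \<open>c\<close> inside \<open>Q i\<close> are
        zero, so \<open>Q i\<close> vanishes everywhere and not only on \<open>Z'\<close>.\<close>
      have Q0: "Q i x = 0" if "i < j" for i x
        unfolding Q_def using less[OF that] that j by (intro sum.neutral ballI) (simp only: mult_zero_left)
      define R where "R x = (\<Sum>i\<in>{j..<N}. Q i x * f m x ^ (i - j))" for x
      have Rpoly: "poly_function_on s V R"
        unfolding R_def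
        by (intro poly_function_on_sum poly_function_on.mult Qpoly poly_function_on_power poly) auto
      have "f m x ^ j * R x = 0" if "x \<in> Z'" for x
      proof -
        have "f m x ^ j * R x = (\<Sum>i\<in>{j..<N}. Q i x * f m x ^ i)"
          unfolding R_def sum_distrib_left
          by (intro sum.cong refl) (auto simp: mult_ac power_add[symmetric])
        also have "\<dots> = (\<Sum>i<N. Q i x * f m x ^ i)"
          by (rule sum.mono_neutral_left) (auto simp: Q0)
        finally show ?thesis using rel'[OF that] by simp
      qed
      then have "(\<forall>x\<in>Z'. f m x ^ j = 0) \<or> (\<forall>x\<in>Z'. R x = 0)"
        by (intro irreducible_closedin_mult_zero[OF irr] poly_function_on_power poly Rpoly) auto
      then have R0: "\<forall>x\<in>Z'. R x = 0"
        using p by auto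
      have "Q j x = 0" if "x \<in> Z" for x
      proof -
        \<comment> \<open>On \<open>Z\<close> every positive power of \<open>f m\<close> is zero;
          the term \<open>i = j\<close> survives because its exponent is \<open>0\<close>.\<close>
        have "R x = (\<Sum>i\<in>{j}. Q i x * f m x ^ (i - j))"
          unfolding R_def using j by (intro sum.mono_neutral_right) (auto simp: zero[OF that])
        then show ?thesis
          using R0 sub that by auto
      qed
      then show "\<forall>\<alpha>\<in>{..<m} \<rightarrow>\<^sub>E {..<N}. c (\<alpha>(m := j)) = 0"
        using indep unfolding alg_indep_on_def Q_def
        by (auto dest!: spec[of _ N] spec[of _ "\<lambda>\<alpha>. c (\<alpha>(m := j))"])
    qed
  qed
  show "\<forall>\<alpha>\<in>{..<Suc m} \<rightarrow>\<^sub>E {..<N}. c \<alpha> = 0"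
    using zeros by (auto simp: lessThan_Suc PiE_insert_eq)
qed

text \<open>Each strict inclusion supplies one more function: an equation of the smaller set that
  fails somewhere on the larger one.\<close>

lemma alg_indep_on_chain:
  assumes irr: "\<And>i. i \<le> d \<Longrightarrow> irreducible_closedin (subtopology (zariski_topology s V) S) (Z i)"
    and less: "\<And>i. i < d \<Longrightarrow> Z i \<subset> Z (Suc i)"
  shows "\<exists>f. (\<forall>i<d. poly_function_on s V (f i)) \<and> alg_indep_on (Z d) f d"
  using assms
proof (induction d)
  case 0
  have "Z 0 \<noteq> {}"
    using 0(1)[of 0] unfolding irreducible_closedin_def by simp
  then show ?case
    by (intro exI[of _ "\<lambda>_ _. 0"] conjI alg_indep_on_0) simp_all
next
  case (Suc d)
  have "\<exists>f. (\<forall>i<d. poly_function_on s V (f i)) \<and> alg_indep_on (Z d) f d"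
  proof (rule Suc.IH)
    show "irreducible_closedin (subtopology (zariski_topology s V) S) (Z i)" if "i \<le> d" for i
      using that by (intro Suc.prems) simp
    show "Z i \<subset> Z (Suc i)" if "i < d" for i
      using that by (intro Suc.prems) simp
  qed
  then obtain f where f: "\<forall>i<d. poly_function_on s V (f i)" "alg_indep_on (Z d) f d"
    by (elim exE conjE)
  have closed: "closedin (subtopology (zariski_topology s V) S) (Z i)" if "i \<le> Suc d" for i
    using Suc.prems(1)[OF that] unfolding irreducible_closedin_def by blast
  obtain F where F: "\<forall>f\<in>F. poly_function_on s V f" "Z d = {x\<in>V \<inter> S. \<forall>f\<in>F. f x = 0}"
    using closed[of d] unfolding closedin_subtopology_zariski by auto
  have F': "Z (Suc d) \<subseteq> V \<inter> S"
    using closedin_subset[OF closed[of "Suc d"]] by simp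
  obtain p where p: "p \<in> Z (Suc d)" "p \<notin> Z d"
    using Suc.prems(2)[of d] by auto
  then obtain g where g: "g \<in> F" "g p \<noteq> 0"
    using F F' by auto
  let ?f = "f(d := g)"
  have poly: "poly_function_on s V (?f i)" if "i \<le> d" for i
    using f(1) F(1) g that by auto
  have indep: "alg_indep_on (Z (Suc d)) ?f (Suc d)"
  proof (rule alg_indep_on_Suc)
    show "alg_indep_on (Z d) ?f d"
      using f(2) unfolding alg_indep_on_def by simp
    show "irreducible_closedin (subtopology (zariski_topology s V) S) (Z (Suc d))"
      by (intro Suc.prems) simp
    show "Z d \<subseteq> Z (Suc d)"
      using Suc.prems(2)[of d] by auto
    show "?f d x = 0" if "x \<in> Z d" for x
      using that F(2) g(1) by auto
    show "p \<in> Z (Suc d)" "?f d p \<noteq> 0"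
      using p g by auto
  qed (rule poly)
  show ?case
    by (intro exI[of _ ?f] conjI allI impI indep) (rule poly, simp)
qed


section \<open>Dimension of parametrized sets\<close>

lemma sum_fun_apply: "(\<Sum>i\<in>A. f i) x = (\<Sum>i\<in>A. f i x)"
  for f :: "'i \<Rightarrow> 'a \<Rightarrow> 'b::comm_monoid_add"
  by (induction A rule: infinite_finite_induct) auto

interpretation fun_space: vector_space "\<lambda>(c::complex) (f :: 'a \<Rightarrow> complex) x. c * f x"
  by unfold_locales (auto simp: fun_eq_iff algebra_simps)

text \<open>Dependence is stated for an indexed family because different monomials may give the same
  function. Two coinciding members yield a relation with coefficients \<open>1\<close> and
  \<open>- 1\<close>; otherwise the bound on independent subsets of a span applies.\<close>

lemma (in vector_space) exists_dependence:
  assumes "finite T" "finite M" "\<And>\<alpha>. \<alpha> \<in> M \<Longrightarrow> g \<alpha> \<in> span T" "card T < card M"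
  shows "\<exists>c. (\<exists>\<alpha>\<in>M. c \<alpha> \<noteq> 0) \<and> (\<Sum>\<alpha>\<in>M. scale (c \<alpha>) (g \<alpha>)) = 0"
proof (cases "inj_on g M")
  case True
  have "dependent (g ` M)"
    using independent_span_bound[OF assms(1), of "g ` M"] assms(3,4) card_image[OF True] by force
  then obtain u v where u: "v \<in> g ` M" "u v \<noteq> 0" "(\<Sum>v\<in>g ` M. scale (u v) v) = 0"
    using dependent_finite[of "g ` M"] assms(2) by auto
  then show ?thesis
    by (intro exI[of _ "u \<circ> g"]) (auto simp: sum.reindex[OF True])
next
  case False
  then obtain \<alpha> \<beta> where ab: "\<alpha> \<in> M" "\<beta> \<in> M" "\<alpha> \<noteq> \<beta>" "g \<alpha> = g \<beta>"
    unfolding inj_on_def by blast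
  let ?c = "\<lambda>\<gamma>. if \<gamma> = \<alpha> then 1 else if \<gamma> = \<beta> then - 1 else 0"
  have "(\<Sum>\<gamma>\<in>M. scale (?c \<gamma>) (g \<gamma>)) = (\<Sum>\<gamma>\<in>{\<alpha>, \<beta>}. scale (?c \<gamma>) (g \<gamma>))"
    using assms(2) ab by (intro sum.mono_neutral_right) auto
  also have "\<dots> = 0"
    using ab by auto
  finally show ?thesis
    using ab by (intro exI[of _ ?c]) auto
qed

section \<open>Polynomials in finitely many parameters and their degree bounds\<close>

definition monomials :: "'i set \<Rightarrow> nat \<Rightarrow> (('i \<Rightarrow> complex) \<Rightarrow> complex) set" where
  "monomials I D = {(\<lambda>t. \<Prod>i\<in>I. t i ^ \<beta> i) | \<beta>. \<forall>i\<in>I. \<beta> i \<le> D}"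

lemma monomials_mono: "D \<le> D' \<Longrightarrow> monomials I D \<subseteq> monomials I D'"
  unfolding monomials_def by (auto intro: order_trans)

lemma monomials_conv_PiE:
  "monomials I D = (\<lambda>\<beta> t. \<Prod>i\<in>I. t i ^ \<beta> i) ` (I \<rightarrow>\<^sub>E {..D})"
proof (intro equalityI subsetI)
  fix g :: "('a \<Rightarrow> complex) \<Rightarrow> complex" assume "g \<in> monomials I D"
  then obtain \<beta> where \<beta>: "g = (\<lambda>t. \<Prod>i\<in>I. t i ^ \<beta> i)" "\<forall>i\<in>I. \<beta> i \<le> D"
    unfolding monomials_def by auto
  show "g \<in> (\<lambda>\<beta> t. \<Prod>i\<in>I. t i ^ \<beta> i) ` (I \<rightarrow>\<^sub>E {..D})"
    using \<beta> by (intro image_eqI[of _ _ "restrict \<beta> I"]) (auto simp: fun_eq_iff)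
qed (auto simp: monomials_def)

lemma finite_monomials: "finite I \<Longrightarrow> finite (monomials I D)"
  unfolding monomials_conv_PiE by (intro finite_imageI finite_PiE) auto

text \<open>Here \<open>D\<close> bounds each exponent separately rather than the total degree, so
  the count is at most a plain power.\<close>

lemma card_monomials_le:
  assumes "finite I"
  shows "card (monomials I D) \<le> Suc D ^ card I"
proof -
  have "card (monomials I D) \<le> card (I \<rightarrow>\<^sub>E {..D})"
    unfolding monomials_conv_PiE using assms by (intro card_image_le finite_PiE) auto
  then show ?thesis
    using assms by (simp add: card_PiE)
qed

abbreviation polys_le :: "'i set \<Rightarrow> nat \<Rightarrow> (('i \<Rightarrow> complex) \<Rightarrow> complex) set" where
  "polys_le I D \<equiv> fun_space.span (monomials I D)"

lemma polys_le_mono: "D \<le> D' \<Longrightarrow> polys_le I D \<subseteq> polys_le I D'"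
  by (intro fun_space.span_mono monomials_mono)

lemma polys_le_const: "(\<lambda>t. c) \<in> polys_le I D"
proof -
  have "(\<lambda>t. 1) \<in> monomials I D"
    unfolding monomials_def by (auto intro: exI[of _ "\<lambda>_. 0"])
  from fun_space.span_scale[OF fun_space.span_base[OF this], of c] show ?thesis by simp
qed

lemma polys_le_var:
  assumes "finite I" "i \<in> I"
  shows "(\<lambda>t. t i) \<in> polys_le I 1"
proof -
  have "(\<Prod>j\<in>I. t j ^ (if j = i then 1 else 0)) = t i" for t :: "'a \<Rightarrow> complex"
  proof -
    have "(\<Prod>j\<in>I. t j ^ (if j = i then 1 else 0)) = (\<Prod>j\<in>I. if j = i then t j else 1)"
      by (intro prod.cong) auto
    also have "\<dots> = t i" using assms by (simp add: prod.delta)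
    finally show ?thesis .
  qed
  then have "(\<lambda>t. t i) \<in> monomials I 1"
    unfolding monomials_def by (auto intro!: exI[of _ "\<lambda>j. if j = i then 1 else 0"])
  then show ?thesis by (rule fun_space.span_base)
qed

lemma polys_le_add: "g \<in> polys_le I D \<Longrightarrow> h \<in> polys_le I D \<Longrightarrow> (\<lambda>t. g t + h t) \<in> polys_le I D"
  using fun_space.span_add[of g _ h] by (simp add: plus_fun_def)

lemma polys_le_cmult: "g \<in> polys_le I D \<Longrightarrow> (\<lambda>t. c * g t) \<in> polys_le I D"
  by (rule fun_space.span_scale)

text \<open>The product is bilinear, so two span inductions reduce the claim to a product of two
  monomials.\<close>

lemma polys_le_mult:
  assumes "g \<in> polys_le I D" "h \<in> polys_le I D'"
  shows "(\<lambda>t. g t * h t) \<in> polys_le I (D + D')"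
  using assms(1)
proof (induction rule: fun_space.span_induct)
  case base
  show ?case
    unfolding fun_space.subspace_def
    by (auto simp: algebra_simps intro: polys_le_add polys_le_const dest: polys_le_cmult)
next
  case (step g)
  from assms(2) show ?case
  proof (induction rule: fun_space.span_induct)
    case base
    show ?case
      unfolding fun_space.subspace_def
      by (auto simp: algebra_simps intro: polys_le_add polys_le_const dest: polys_le_cmult)
  next
    case (step h)
    obtain \<beta> \<gamma> where "g = (\<lambda>t. \<Prod>i\<in>I. t i ^ \<beta> i)" "\<forall>i\<in>I. \<beta> i \<le> D"
      "h = (\<lambda>t. \<Prod>i\<in>I. t i ^ \<gamma> i)" "\<forall>i\<in>I. \<gamma> i \<le> D'"
      using step \<open>g \<in> monomials I D\<close> unfolding monomials_def by auto
    then have "(\<lambda>t. g t * h t) \<in> monomials I (D + D')"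
      unfolding monomials_def
      by (auto simp: prod.distrib[symmetric] power_add[symmetric] add_mono intro!: exI[of _ "\<lambda>i. \<beta> i + \<gamma> i"])
    then show ?case by (rule fun_space.span_base)
  qed
qed

lemma polys_le_power: "g \<in> polys_le I D \<Longrightarrow> (\<lambda>t. g t ^ k) \<in> polys_le I (k * D)"
  by (induction k) (auto intro: polys_le_const polys_le_mult)

lemma polys_le_prod:
  "finite A \<Longrightarrow> (\<And>i. i \<in> A \<Longrightarrow> g i \<in> polys_le I (D i)) \<Longrightarrow> (\<lambda>t. \<Prod>i\<in>A. g i t) \<in> polys_le I (\<Sum>i\<in>A. D i)"
  by (induction A rule: finite_induct) (auto intro: polys_le_const polys_le_mult)

definition poly_param :: "'i set \<Rightarrow> (('i \<Rightarrow> complex) \<Rightarrow> complex) \<Rightarrow> bool" where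
  "poly_param I g \<longleftrightarrow> (\<exists>D. g \<in> polys_le I D)"

lemma poly_param_const: "poly_param I (\<lambda>t. c)"
  unfolding poly_param_def by (intro exI polys_le_const)

lemma poly_param_var: "finite I \<Longrightarrow> i \<in> I \<Longrightarrow> poly_param I (\<lambda>t. t i)"
  unfolding poly_param_def using polys_le_var[of I i] by (intro exI[of _ 1]) simp

lemma poly_param_add: "poly_param I g \<Longrightarrow> poly_param I h \<Longrightarrow> poly_param I (\<lambda>t. g t + h t)"
  unfolding poly_param_def
proof (elim exE)
  fix D D' assume "g \<in> polys_le I D" "h \<in> polys_le I D'"
  then have "g \<in> polys_le I (max D D')" "h \<in> polys_le I (max D D')"
    using polys_le_mono[of _ "max D D'" I] by (meson max.cobounded1 max.cobounded2 subsetD)+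
  then show "\<exists>D. (\<lambda>t. g t + h t) \<in> polys_le I D"
    by (intro exI polys_le_add)
qed

lemma poly_param_mult: "poly_param I g \<Longrightarrow> poly_param I h \<Longrightarrow> poly_param I (\<lambda>t. g t * h t)"
  unfolding poly_param_def by (elim exE, rule exI, rule polys_le_mult)

lemma poly_param_sum:
  "(\<And>i. i \<in> A \<Longrightarrow> poly_param I (g i)) \<Longrightarrow> poly_param I (\<lambda>t. \<Sum>i\<in>A. g i t)"
  by (induction A rule: infinite_finite_induct) (auto intro: poly_param_const poly_param_add)

lemma poly_params_common_degree:
  assumes "finite A" "\<And>a. a \<in> A \<Longrightarrow> poly_param (I a) (g a)"
  shows "\<exists>D. \<forall>a\<in>A. g a \<in> polys_le (I a) D"
  using assms
proof (induction A rule: finite_induct)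
  case (insert a A)
  then obtain D where D: "\<forall>a\<in>A. g a \<in> polys_le (I a) D"
    by blast
  obtain D' where D': "g a \<in> polys_le (I a) D'"
    using insert.prems[of a] unfolding poly_param_def by blast
  have "\<forall>b\<in>insert a A. g b \<in> polys_le (I b) (max D D')"
  proof
    fix b assume "b \<in> insert a A"
    then have "g b \<in> polys_le (I b) D \<or> g b \<in> polys_le (I b) D'"
      using D D' by blast
    then show "g b \<in> polys_le (I b) (max D D')"
      using polys_le_mono[of D "max D D'" "I b"] polys_le_mono[of D' "max D D'" "I b"] by auto
  qed
  then show ?case ..
qed auto

text \<open>The monomials with exponents below \<open>N\<close> in \<open>e + 1\<close> functions number \<open>N\<^sup>e\<^sup>+\<^sup>1\<close>, but pulled back to
  the parameters they lie in a space of dimension \<open>O(N\<^sup>e)\<close>.\<close>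
lemma not_alg_indep_on_parametrized:
  fixes \<phi> :: "'k \<Rightarrow> ('i \<Rightarrow> complex) \<Rightarrow> 'v"
  assumes K: "finite K" and I: "\<And>k. k \<in> K \<Longrightarrow> finite (I k)" "\<And>k. k \<in> K \<Longrightarrow> card (I k) \<le> e"
    and cover: "S \<subseteq> (\<Union>k\<in>K. range (\<phi> k))"
    and poly: "\<And>i k. i < Suc e \<Longrightarrow> k \<in> K \<Longrightarrow> poly_param (I k) (\<lambda>t. f i (\<phi> k t))"
  shows "\<not> alg_indep_on S f (Suc e)"
proof
  assume indep: "alg_indep_on S f (Suc e)"
  define m where "m = Suc e"
  have "\<exists>D. \<forall>a\<in>{..<m} \<times> K. (\<lambda>t. f (fst a) (\<phi> (snd a) t)) \<in> polys_le (I (snd a)) D"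
  proof (rule poly_params_common_degree)
    fix a assume "a \<in> {..<m} \<times> K"
    then have "fst a < Suc e" "snd a \<in> K"
      by (auto simp: m_def)
    then show "poly_param (I (snd a)) (\<lambda>t. f (fst a) (\<phi> (snd a) t))"
      by (rule poly)
  qed (simp add: K)
  then obtain D where D': "\<forall>a\<in>{..<m} \<times> K. (\<lambda>t. f (fst a) (\<phi> (snd a) t)) \<in> polys_le (I (snd a)) D" ..
  have D: "(\<lambda>t. f i (\<phi> k t)) \<in> polys_le (I k) D" if "i < m" "k \<in> K" for i k
    using bspec[OF D', of "(i, k)"] that by simp
  \<comment> \<open>\<open>N\<close> exceeds the constant in the bound
    \<open>card K * Suc (m * D) ^ e * N ^ e\<close> for the pulled-back space, so that bound falls
    below \<open>N ^ Suc e\<close>.\<close>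
  define N where "N = Suc (card K * Suc (m * D) ^ e)"
  have "N \<ge> 1"
    by (simp add: N_def)
  define M where "M = {..<m} \<rightarrow>\<^sub>E {..<N}"
  \<comment> \<open>All pieces are treated at once, as functions on the disjoint union of the
    parameter spaces: a single relation must hold on every piece, and \<open>lift\<close> extends a
    function on one piece by zero.\<close>
  define lift where "lift k g = (\<lambda>(k', t). if k' = k then g t else 0)"
    for k :: 'k and g :: "('i \<Rightarrow> complex) \<Rightarrow> complex"
  \<comment> \<open>A product of \<open>m\<close> powers with exponents below \<open>N\<close> of
    functions of degree at most \<open>D\<close> has degree at most \<open>m * (N * D)\<close> in
    each parameter.\<close>
  define T where "T = (\<Union>k\<in>K. lift k ` monomials (I k) (m * (N * D)))"
  define G where "G \<alpha> = (\<lambda>(k, t). if k \<in> K then \<Prod>i<m. f i (\<phi> k t) ^ \<alpha> i else 0)"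
    for \<alpha> :: "nat \<Rightarrow> nat"
  have finT: "finite T"
    unfolding T_def using K I by (auto intro: finite_monomials)
  have finM: "finite M"
    unfolding M_def by (intro finite_PiE) auto
  have "card T \<le> (\<Sum>k\<in>K. card (lift k ` monomials (I k) (m * (N * D))))"
    unfolding T_def by (rule card_UN_le[OF K])
  also have "\<dots> \<le> (\<Sum>k\<in>K. Suc (m * (N * D)) ^ e)"
  proof (rule sum_mono)
    fix k assume k: "k \<in> K"
    have "card (lift k ` monomials (I k) (m * (N * D))) \<le> Suc (m * (N * D)) ^ card (I k)"
      using card_image_le[OF finite_monomials] card_monomials_le I(1)[OF k] order_trans by blast
    also have "\<dots> \<le> Suc (m * (N * D)) ^ e"
      using I(2)[OF k] by (intro power_increasing) auto
    finally show "card (lift k ` monomials (I k) (m * (N * D))) \<le> Suc (m * (N * D)) ^ e" .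
  qed
  also have "\<dots> \<le> card K * (N * Suc (m * D)) ^ e"
  proof -
    have "Suc (m * (N * D)) \<le> N * Suc (m * D)"
      using \<open>N \<ge> 1\<close> by (simp add: algebra_simps)
    then show ?thesis
      by (simp add: power_mono)
  qed
  also have "\<dots> = (card K * Suc (m * D) ^ e) * N ^ e"
    by (simp only: power_mult_distrib mult_ac)
  also have "\<dots> < N * N ^ e"
    by (intro mult_strict_right_mono) (auto simp: N_def)
  also have "\<dots> = card M"
    by (simp add: M_def card_PiE m_def)
  finally have card: "card T < card M" .
  have lift_span: "lift k g \<in> fun_space.span T" if "k \<in> K" "g \<in> polys_le (I k) (m * (N * D))" for k g
    using that(2)
  proof (induction rule: fun_space.span_induct)
    case base
    have "lift k (\<lambda>t. 0) = 0" "lift k (\<lambda>t. a t + b t) = lift k a + lift k b"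
      "lift k (\<lambda>t. c * a t) = (\<lambda>x. c * lift k a x)" for a b c
      by (auto simp: lift_def fun_eq_iff)
    then show ?case
      unfolding fun_space.subspace_def
      by (auto simp: plus_fun_def[of "_ :: ('i \<Rightarrow> complex) \<Rightarrow> complex"] zero_fun_def[where 'a = "'i \<Rightarrow> complex"]
          intro: fun_space.span_zero fun_space.span_add fun_space.span_scale)
  next
    case (step g)
    with that(1) show ?case
      by (auto simp: T_def intro: fun_space.span_base)
  qed
  have G_span: "G \<alpha> \<in> fun_space.span T" if \<alpha>: "\<alpha> \<in> M" for \<alpha>
  proof -
    have "(\<lambda>t. \<Prod>i<m. f i (\<phi> k t) ^ \<alpha> i) \<in> polys_le (I k) (m * (N * D))" if "k \<in> K" for k
    proof -
      have "(\<lambda>t. \<Prod>i<m. f i (\<phi> k t) ^ \<alpha> i) \<in> polys_le (I k) (\<Sum>i<m. \<alpha> i * D)"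
        using D that by (intro polys_le_prod polys_le_power) auto
      moreover have "(\<Sum>i<m. \<alpha> i * D) \<le> (\<Sum>i<m. N * D)"
        using \<alpha> by (intro sum_mono mult_right_mono) (auto simp: M_def PiE_def Pi_def less_imp_le)
      ultimately show ?thesis
        using polys_le_mono by fastforce
    qed
    then have "(\<Sum>k\<in>K. lift k (\<lambda>t. \<Prod>i<m. f i (\<phi> k t) ^ \<alpha> i)) \<in> fun_space.span T"
      by (intro fun_space.span_sum lift_span)
    moreover have "(\<Sum>k\<in>K. lift k (\<lambda>t. \<Prod>i<m. f i (\<phi> k t) ^ \<alpha> i)) = G \<alpha>"
      using K by (auto simp: fun_eq_iff lift_def G_def sum_fun_apply sum.delta)
    ultimately show ?thesis by simp
  qed
  have "\<exists>c. (\<exists>\<alpha>\<in>M. c \<alpha> \<noteq> 0) \<and> (\<Sum>\<alpha>\<in>M. (\<lambda>x. c \<alpha> * G \<alpha> x)) = 0"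
    using G_span by (rule fun_space.exists_dependence[OF finT finM _ card])
  then obtain c where c: "\<exists>\<alpha>\<in>M. c \<alpha> \<noteq> 0" "(\<Sum>\<alpha>\<in>M. (\<lambda>x. c \<alpha> * G \<alpha> x)) = 0"
    by (elim exE conjE)
  have "(\<Sum>\<alpha>\<in>M. c \<alpha> * (\<Prod>i<m. f i x ^ \<alpha> i)) = 0" if x: "x \<in> S" for x
  proof -
    obtain k t where kt: "k \<in> K" "x = \<phi> k t"
      using x cover by auto
    have "(\<Sum>\<alpha>\<in>M. (\<lambda>x. c \<alpha> * G \<alpha> x)) (k, t) = 0"
      using c(2) by simp
    then show ?thesis
      using kt by (simp add: sum_fun_apply G_def)
  qed
  then show False
    using indep c(1) unfolding alg_indep_on_def m_def[symmetric] M_def by blast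
qed

text \<open>A chain longer than \<open>e\<close> would give \<open>e + 1\<close> functions
  independent on one of its members, hence on \<open>S\<close>, against the counting
  argument.\<close>

lemma krull_dim_parametrized_le:
  fixes \<phi> :: "'k \<Rightarrow> ('i \<Rightarrow> complex) \<Rightarrow> 'v::ab_group_add"
  assumes K: "finite K" and I: "\<And>k. k \<in> K \<Longrightarrow> finite (I k)" "\<And>k. k \<in> K \<Longrightarrow> card (I k) \<le> e"
    and cover: "S \<subseteq> (\<Union>k\<in>K. range (\<phi> k))"
    and poly: "\<And>f k. poly_function_on s V f \<Longrightarrow> k \<in> K \<Longrightarrow> poly_param (I k) (\<lambda>t. f (\<phi> k t))"
  shows "krull_dim (subtopology (zariski_topology s V) S) \<le> ereal (real e)"
  unfolding krull_dim_def
proof (rule Sup_least, clarify)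
  fix d Z
  assume irr: "\<forall>i\<le>d. irreducible_closedin (subtopology (zariski_topology s V) S) (Z i)"
    and less: "\<forall>i<d. Z i \<subset> Z (Suc i)"
  have "d \<le> e"
  proof (rule ccontr)
    assume "\<not> d \<le> e"
    then obtain f where f: "\<forall>i<Suc e. poly_function_on s V (f i)" "alg_indep_on (Z (Suc e)) f (Suc e)"
      \<comment> \<open>The chain is cut off at index \<open>Suc e\<close>, since exactly
        \<open>e + 1\<close> functions are wanted.\<close>
      using alg_indep_on_chain[of "Suc e" s V S Z] irr less by auto
    have "irreducible_closedin (subtopology (zariski_topology s V) S) (Z (Suc e))"
      using irr \<open>\<not> d \<le> e\<close> by auto
    then have "Z (Suc e) \<subseteq> S"
      using closedin_subset unfolding irreducible_closedin_def by fastforce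
    then have "alg_indep_on S f (Suc e)"
      using alg_indep_on_mono f(2) by blast
    moreover have pp: "poly_param (I k) (\<lambda>t. f i (\<phi> k t))" if "i < Suc e" "k \<in> K" for i k
      using f(1) that by (intro poly[of "f i"]) auto
    have "\<not> alg_indep_on S f (Suc e)"
      by (rule not_alg_indep_on_parametrized[where I = I, OF K I cover pp])
    ultimately show False by blast
  qed
  then show "ereal (real d) \<le> ereal (real e)" by simp
qed


section \<open>Dual bases and open sets\<close>

lemma linear_functional_on_sum:
  assumes s: "vector_space s" and V: "module.subspace s V" and f: "linear_functional_on s V f"
    and e: "\<And>i. i \<in> A \<Longrightarrow> e i \<in> V"
  shows "f (\<Sum>i\<in>A. s (c i) (e i)) = (\<Sum>i\<in>A. c i * f (e i))"
proof -
  interpret vector_space s by (fact s)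
  have zero: "f 0 = 0"
    using f V subspace_0[OF V] scale_zero_left[of 0] unfolding linear_functional_on_def
    by (metis mult_zero_left)
  show ?thesis
    using e
  proof (induction A rule: infinite_finite_induct)
    case (insert i A)
    have "(\<Sum>i\<in>A. s (c i) (e i)) \<in> V" "s (c i) (e i) \<in> V"
      using insert by (auto intro!: subspace_sum V subspace_scale)
    then show ?case
      using insert f by (simp add: linear_functional_on_def)
  qed (simp_all add: zero)
qed

text \<open>If a basis had more than \<open>card I\<close> elements, their coordinate vectors under
  the \<open>f i\<close> would be dependent. The same combination of basis vectors is then killed by
  all \<open>f i\<close>, hence zero, contradicting independence.\<close>

lemma dim_le_card_functionals:
  assumes s: "vector_space s" and V: "module.subspace s V" and I: "finite I"
    and f: "\<And>i. i \<in> I \<Longrightarrow> linear_functional_on s V (f i)"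
    and inj: "\<And>x. x \<in> V \<Longrightarrow> \<forall>i\<in>I. f i x = 0 \<Longrightarrow> x = 0"
  shows "vector_space.dim s V \<le> card I"
proof (rule ccontr)
  interpret vector_space s by (fact s)
  assume less: "\<not> dim V \<le> card I"
  obtain B where B: "B \<subseteq> V" "independent B" "card B = dim V"
    using basis_exists[of V] by metis
  \<comment> \<open>An infinite \<open>B\<close> would have \<open>card B = 0\<close>, contrary to
    the assumed strict inequality.\<close>
  have finB: "finite B"
    using B(3) less by (metis card.infinite le0)
  define \<delta> :: "'b \<Rightarrow> 'b \<Rightarrow> complex" where "\<delta> i = (\<lambda>j. if j = i then 1 else 0)" for i
  define g where "g b = (\<lambda>i. if i \<in> I then f i b else 0)" for b
  have g_span: "g b \<in> fun_space.span (\<delta> ` I)" for b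
  proof -
    have "(\<Sum>i\<in>I. (\<lambda>j. f i b * \<delta> i j)) \<in> fun_space.span (\<delta> ` I)"
      by (intro fun_space.span_sum fun_space.span_scale fun_space.span_base imageI)
    also have "(\<Sum>i\<in>I. (\<lambda>j. f i b * \<delta> i j)) = g b"
      using I by (auto simp: fun_eq_iff sum_fun_apply \<delta>_def g_def if_distrib cong: if_cong)
    finally show ?thesis .
  qed
  have "card (\<delta> ` I) < card B"
    using card_image_le[OF I, of \<delta>] less B(3) by linarith
  then have "\<exists>c. (\<exists>b\<in>B. c b \<noteq> 0) \<and> (\<Sum>b\<in>B. (\<lambda>x. c b * g b x)) = 0"
    by (intro fun_space.exists_dependence[of "\<delta> ` I"] g_span finB finite_imageI I)
  then obtain c where c: "\<exists>b\<in>B. c b \<noteq> 0" "(\<Sum>b\<in>B. (\<lambda>x. c b * g b x)) = 0"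
    by blast
  have "(\<Sum>b\<in>B. s (c b) b) = 0"
  proof (rule inj)
    show "(\<Sum>b\<in>B. s (c b) b) \<in> V"
      using B(1) by (intro subspace_sum V subspace_scale) auto
    show "\<forall>i\<in>I. f i (\<Sum>b\<in>B. s (c b) b) = 0"
    proof
      fix i assume i: "i \<in> I"
      have "f i (\<Sum>b\<in>B. s (c b) b) = (\<Sum>b\<in>B. c b * f i b)"
        using B(1) by (intro linear_functional_on_sum[OF s V f[OF i]]) auto
      also have "\<dots> = (\<Sum>b\<in>B. (\<lambda>x. c b * g b x)) i"
        using i by (simp add: sum_fun_apply g_def)
      finally show "f i (\<Sum>b\<in>B. s (c b) b) = 0"
        using c(2) by simp
    qed
  qed
  then show False
    using c(1) B(2) dependent_finite[OF finB] by blast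
qed

locale dual_basis = vector_space s for s :: "complex \<Rightarrow> 'v \<Rightarrow> 'v::ab_group_add" +
  fixes V :: "'v set" and I :: "'i set" and f :: "'i \<Rightarrow> 'v \<Rightarrow> complex" and e :: "'i \<Rightarrow> 'v"
  assumes subspace: "subspace V" and finite_index: "finite I"
    and linear: "\<And>i. i \<in> I \<Longrightarrow> linear_functional_on s V (f i)"
    and inj: "\<And>x. x \<in> V \<Longrightarrow> \<forall>i\<in>I. f i x = 0 \<Longrightarrow> x = 0"
    and basis_in: "\<And>i. i \<in> I \<Longrightarrow> e i \<in> V"
    and dual: "\<And>i j. i \<in> I \<Longrightarrow> j \<in> I \<Longrightarrow> f i (e j) = of_bool (i = j)"
begin

lemma functional_sum:
  assumes i: "i \<in> I"
  shows "f i (\<Sum>j\<in>I. s (c j) (e j)) = c i"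
proof -
  have "f i (\<Sum>j\<in>I. s (c j) (e j)) = (\<Sum>j\<in>I. c j * f i (e j))"
    using basis_in by (intro linear_functional_on_sum[OF vector_space_axioms subspace linear[OF i]])
  also have "\<dots> = (\<Sum>j\<in>I. if j = i then c j else 0)"
    using i dual by (intro sum.cong) auto
  finally show ?thesis
    using i finite_index by simp
qed

text \<open>The difference of the two sides is killed by every coordinate functional, so it is zero
  by \<open>inj\<close>.\<close>

lemma expansion:
  assumes x: "x \<in> V"
  shows "x = (\<Sum>i\<in>I. s (f i x) (e i))"
proof -
  define y where "y = (\<Sum>i\<in>I. s (f i x) (e i))"
  have y: "y \<in> V"
    unfolding y_def using basis_in by (intro subspace_sum subspace subspace_scale)
  have "x + s (- 1) y = 0"
  proof (rule inj)
    show "x + s (- 1) y \<in> V"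
      using x y by (intro subspace_add subspace_scale subspace)
    show "\<forall>i\<in>I. f i (x + s (- 1) y) = 0"
    proof
      fix i assume i: "i \<in> I"
      have "f i y = f i x"
        unfolding y_def by (rule functional_sum[OF i])
      moreover have "s (- 1) y \<in> V"
        using y by (intro subspace_scale subspace)
      ultimately show "f i (x + s (- 1) y) = 0"
        using linear[OF i] x y by (simp add: linear_functional_on_def del: scale_minus_left)
    qed
  qed
  then show ?thesis
    by (simp add: y_def)
qed

lemma dim_eq_card: "dim V = card I"
proof -
  have inj_e: "inj_on e I"
  proof (rule inj_onI)
    fix i j assume "i \<in> I" "j \<in> I" "e i = e j"
    then show "i = j"
      using dual[of i i] dual[of i j] by (auto split: if_splits)
  qed
  have "independent (e ` I)"
  proof (rule independent_if_scalars_zero)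
    fix c x assume eq: "(\<Sum>x\<in>e ` I. s (c x) x) = 0" and "x \<in> e ` I"
    then obtain i where i: "i \<in> I" "x = e i" by blast
    have "0 = f i (\<Sum>j\<in>I. s 0 (e j))"
      by (subst functional_sum[OF i(1)]) simp
    also have "(\<Sum>j\<in>I. s 0 (e j)) = (\<Sum>j\<in>I. s (c (e j)) (e j))"
      using eq by (simp add: sum.reindex[OF inj_e])
    also have "f i \<dots> = c x"
      using functional_sum[OF i(1), of "\<lambda>j. c (e j)"] i(2) by simp
    finally show "c x = 0" ..
  qed (simp add: finite_index)
  moreover have "V \<subseteq> span (e ` I)"
  proof
    fix x assume x: "x \<in> V"
    have "(\<Sum>i\<in>I. s (f i x) (e i)) \<in> span (e ` I)"
      by (intro span_sum span_scale span_base imageI)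
    then show "x \<in> span (e ` I)"
      using expansion[OF x] by simp
  qed
  moreover have "e ` I \<subseteq> V"
    using basis_in by auto
  ultimately show ?thesis
    using basis_card_eq_dim card_image[OF inj_e] by metis
qed

text \<open>Polynomial functions are generated by linear ones, and a linear function is a
  combination of the coordinates; so polynomial dependence on the parameters need only be checked
  for coordinates.\<close>

lemma poly_param_comp:
  assumes g: "poly_function_on s V g" and \<phi>: "\<And>t. \<phi> t \<in> V"
    and coord: "\<And>i. i \<in> I \<Longrightarrow> poly_param J (\<lambda>t. f i (\<phi> t))"
  shows "poly_param J (\<lambda>t. g (\<phi> t))"
  using g
proof (induction rule: poly_function_on.induct)
  case (linear g)
  have "g (\<phi> t) = (\<Sum>i\<in>I. f i (\<phi> t) * g (e i))" for t
    using linear_functional_on_sum[OF vector_space_axioms subspace linear, of I e "\<lambda>i. f i (\<phi> t)"]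
      expansion[OF \<phi>[of t]] basis_in by simp
  then show ?case
    by (simp only:) (intro poly_param_sum poly_param_mult poly_param_const coord)
qed (intro poly_param_const poly_param_add poly_param_mult; assumption)+

end

section \<open>Restriction to lines, irreducibility of linear sections and lower bounds for
  dimension\<close>

lemma poly_function_on_line:
  assumes s: "vector_space s" and V: "module.subspace s V" and f: "poly_function_on s V f"
    and pq: "p \<in> V" "q \<in> V"
  shows "\<exists>P. \<forall>t. f (s (1 - t) p + s t q) = poly P t"
proof -
  interpret vector_space s by (fact s)
  show ?thesis
    using f
  proof (induction rule: poly_function_on.induct)
    case (linear f)
    have "f (s (1 - t) p + s t q) = (1 - t) * f p + t * f q" for t
      using linear pq subspace_scale[OF V] unfolding linear_functional_on_def by simp
    then show ?case
      by (intro exI[of _ "[:f p, f q - f p:]"]) (simp add: left_diff_distrib right_diff_distrib)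
  next
    case (const c)
    show ?case by (rule exI[of _ "[:c:]"]) simp
  next
    case (add f g)
    then obtain P Q where "\<forall>t. f (s (1 - t) p + s t q) = poly P t" "\<forall>t. g (s (1 - t) p + s t q) = poly Q t"
      by auto
    then show ?case by (intro exI[of _ "P + Q"]) simp
  next
    case (mult f g)
    then obtain P Q where "\<forall>t. f (s (1 - t) p + s t q) = poly P t" "\<forall>t. g (s (1 - t) p + s t q) = poly Q t"
      by auto
    then show ?case by (intro exI[of _ "P * Q"]) simp
  qed
qed

text \<open>On the line from \<open>p\<close> to \<open>q\<close> both functions become univariate
  polynomials, nonzero at \<open>0\<close> and at \<open>1\<close> respectively; their product is
  nonzero and has a non-root.\<close>

lemma poly_function_on_mult_nonzero:
  assumes s: "vector_space s" and V: "module.subspace s V" and L: "L \<subseteq> V"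
    and lines: "\<And>p q t. p \<in> L \<Longrightarrow> q \<in> L \<Longrightarrow> s (1 - t) p + s t q \<in> L"
    and f: "poly_function_on s V f" and g: "poly_function_on s V g"
    and p: "p \<in> L" "f p \<noteq> 0" and q: "q \<in> L" "g q \<noteq> 0"
  shows "\<exists>x\<in>L. f x * g x \<noteq> 0"
proof -
  interpret vector_space s by (fact s)
  obtain P Q where P: "\<forall>t. f (s (1 - t) p + s t q) = poly P t"
    and Q: "\<forall>t. g (s (1 - t) p + s t q) = poly Q t"
    using poly_function_on_line[OF s V f] poly_function_on_line[OF s V g] p q L by (meson subsetD)
  have "P \<noteq> 0"
    using P[rule_format, of 0] p by auto
  moreover have "Q \<noteq> 0"
    using Q[rule_format, of 1] q by auto
  ultimately have "P * Q \<noteq> 0" by simp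
  then obtain t where "poly (P * Q) t \<noteq> 0"
    using poly_all_0_iff_0[of "P * Q"] by blast
  then show ?thesis
    using P Q lines[OF p(1) q(1), of t] by (intro bexI[of _ "s (1 - t) p + s t q"]) auto
qed

text \<open>If \<open>A\<close> and \<open>B\<close> were both proper, equations \<open>f\<close> of
  \<open>A\<close> and \<open>g\<close> of \<open>B\<close> would each be nonzero somewhere on
  \<open>L\<close>. Then \<open>f * g * h\<close> is nonzero at some point of \<open>L\<close>; that
  point lies in \<open>S\<close> because of \<open>h\<close>, hence in \<open>A\<close> or
  \<open>B\<close>, where \<open>f * g\<close> is zero.\<close>

lemma irreducible_closedin_Int_lines:
  assumes s: "vector_space s" and V: "module.subspace s V" and L: "L \<subseteq> V"
    and lines: "\<And>p q t. p \<in> L \<Longrightarrow> q \<in> L \<Longrightarrow> s (1 - t) p + s t q \<in> L"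
    and h: "poly_function_on s V h" and p: "p \<in> L" "h p \<noteq> 0"
    and S: "\<And>x. x \<in> V \<Longrightarrow> h x \<noteq> 0 \<Longrightarrow> x \<in> S"
    and closed: "closedin (subtopology (zariski_topology s V) S) (L \<inter> S)"
  shows "irreducible_closedin (subtopology (zariski_topology s V) S) (L \<inter> S)"
  unfolding irreducible_closedin_def
proof (intro conjI allI impI closed)
  show "L \<inter> S \<noteq> {}"
    using p S L by blast
  fix A B
  assume A: "closedin (subtopology (zariski_topology s V) S) A"
    and B: "closedin (subtopology (zariski_topology s V) S) B" and AB: "L \<inter> S = A \<union> B"
  show "L \<inter> S = A \<or> L \<inter> S = B"
  proof (rule ccontr)
    assume "\<not> (L \<inter> S = A \<or> L \<inter> S = B)"
    then obtain a b where a: "a \<in> L \<inter> S" "a \<notin> A" and b: "b \<in> L \<inter> S" "b \<notin> B"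
      using AB by blast
    obtain F where F: "\<forall>f\<in>F. poly_function_on s V f" "A = {x\<in>V \<inter> S. \<forall>f\<in>F. f x = 0}"
      using A unfolding closedin_subtopology_zariski by blast
    obtain G where G: "\<forall>f\<in>G. poly_function_on s V f" "B = {x\<in>V \<inter> S. \<forall>f\<in>G. f x = 0}"
      using B unfolding closedin_subtopology_zariski by blast
    obtain f where f: "f \<in> F" "f a \<noteq> 0" using a L F(2) by blast
    obtain g where g: "g \<in> G" "g b \<noteq> 0" using b L G(2) by blast
    have "\<exists>x\<in>L. f x * g x \<noteq> 0"
      using a b f g F(1) G(1) by (intro poly_function_on_mult_nonzero[OF s V L lines]) auto
    then obtain x where x: "x \<in> L" "f x * g x \<noteq> 0" by (elim bexE)
    have "\<exists>y\<in>L. (f y * g y) * h y \<noteq> 0"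
    proof (rule poly_function_on_mult_nonzero[where p = x and q = p, OF s V L lines])
      show "poly_function_on s V (\<lambda>y. f y * g y)"
        using f(1) g(1) F(1) G(1) by (intro poly_function_on.mult) auto
      show "poly_function_on s V h" "x \<in> L" "f x * g x \<noteq> 0" "p \<in> L" "h p \<noteq> 0"
        by (fact h x p)+
    qed
    then obtain y where y: "y \<in> L" "f y * g y * h y \<noteq> 0" by (elim bexE)
    then have "y \<in> A \<union> B"
      using S[of y] L AB by auto
    then show False
      using y F(2) G(2) f(1) g(1) by auto
  qed
qed

text \<open>The chain comes from a flag of affine subspaces through \<open>p\<close>:
  \<open>L i\<close> fixes the coordinates from \<open>i\<close> to \<open>d - 1\<close> at their
  values at \<open>p\<close>. All of them contain \<open>p\<close>, where \<open>h\<close> is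
  nonzero, so their traces on \<open>S\<close> are irreducible.\<close>

lemma krull_dim_ge_open:
  assumes s: "vector_space s" and V: "module.subspace s V"
    and h: "poly_function_on s V h" and p: "p \<in> V" "h p \<noteq> 0"
    and S: "\<And>x. x \<in> V \<Longrightarrow> h x \<noteq> 0 \<Longrightarrow> x \<in> S"
    and c: "\<And>i. i < d \<Longrightarrow> linear_functional_on s V (c i)"
    and e: "\<And>i. i < d \<Longrightarrow> e i \<in> V"
    and dual: "\<And>i j. i < d \<Longrightarrow> j < d \<Longrightarrow> c i (e j) = of_bool (i = j)"
  shows "ereal (real d) \<le> krull_dim (subtopology (zariski_topology s V) S)"
proof -
  interpret vector_space s by (fact s)
  define L where "L i = {x\<in>V. \<forall>j\<in>{i..<d}. c j x = c j p}" for i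
  have comb: "s (1 - t) x + s t y \<in> V" if "x \<in> V" "y \<in> V" for t x y
    using that by (intro subspace_add subspace_scale V)
  have c_comb: "c j (s (1 - t) x + s t y) = (1 - t) * c j x + t * c j y"
    if "x \<in> V" "y \<in> V" "j < d" for t x y j
    using that c subspace_scale[OF V] by (simp add: linear_functional_on_def)
  have lines: "s (1 - t) x + s t y \<in> L i" if "x \<in> L i" "y \<in> L i" for t x y i
  proof -
    have "(1 - t) * a + t * a = a" for a
      by (simp add: algebra_simps)
    then show ?thesis
      using that comb by (simp add: L_def c_comb)
  qed
  have irr: "irreducible_closedin (subtopology (zariski_topology s V) S) (L i \<inter> S)" for i
  proof (rule irreducible_closedin_Int_lines[OF s V _ lines h _ p(2) S])
    show "L i \<subseteq> V" "p \<in> L i"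
      using p by (auto simp: L_def)
    show "closedin (subtopology (zariski_topology s V) S) (L i \<inter> S)"
      unfolding closedin_subtopology_zariski
    proof (intro exI conjI ballI)
      fix f assume "f \<in> (\<lambda>j x. c j x + - c j p) ` {i..<d}"
      then obtain j where j: "j < d" "f = (\<lambda>x. c j x + - c j p)"
        by auto
      show "poly_function_on s V f"
        unfolding j(2) by (rule poly_function_on.add[OF poly_function_on.linear[OF c[OF j(1)]] poly_function_on.const])
    next
      show "L i \<inter> S = {x\<in>V \<inter> S. \<forall>f\<in>(\<lambda>j x. c j x + - c j p) ` {i..<d}. f x = 0}"
        by (auto simp: L_def)
    qed
  qed
  have less: "L i \<inter> S \<subset> L (Suc i) \<inter> S" if i: "i < d" for i
  proof
    show "L i \<inter> S \<subseteq> L (Suc i) \<inter> S"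
      by (auto simp: L_def)
    have pe: "p + e i \<in> V"
      using p e[OF i] by (intro subspace_add V)
    obtain P where P: "\<forall>t. h (s (1 - t) p + s t (p + e i)) = poly P t"
      using poly_function_on_line[OF s V h p(1) pe] by blast
    have "P \<noteq> 0"
      using P[rule_format, of 0] p by auto
    \<comment> \<open>The factor \<open>[:0, 1:]\<close> forces \<open>t\<close> to be nonzero
      besides \<open>h\<close> being nonzero at the new point, so that the coordinate
      \<open>i\<close> really changes.\<close>
    then have "[:0, 1:] * P \<noteq> 0"
      by (metis mult_eq_0_iff one_neq_zero pCons_eq_0_iff)
    then obtain t where t: "poly ([:0, 1:] * P) t \<noteq> 0"
      using poly_all_0_iff_0[of "[:0, 1:] * P"] by blast
    define x where "x = s (1 - t) p + s t (p + e i)"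
    have x: "x \<in> V" unfolding x_def by (rule comb[OF p(1) pe])
    have cx: "c j x = c j p + t * of_bool (j = i)" if "j < d" for j
    proof -
      have "c j (p + e i) = c j p + of_bool (j = i)"
        using c[OF that] p(1) e[OF i] dual[OF that i] unfolding linear_functional_on_def by simp
      moreover have "(1 - t) * a + t * (a + b) = a + t * b" for a b
        by (simp add: algebra_simps)
      ultimately show ?thesis
        unfolding x_def c_comb[OF p(1) pe that] by simp
    qed
    have "x \<in> S"
      using P[rule_format, of t] t by (intro S x) (simp add: x_def)
    then have "x \<in> L (Suc i) \<inter> S"
      using x cx unfolding L_def by simp
    moreover have "x \<notin> L i"
    proof
      assume "x \<in> L i"
      then have "c i x = c i p"
        using i by (simp add: L_def)
      then show False
        using t cx[OF i] by simp
    qed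
    ultimately show "L i \<inter> S \<noteq> L (Suc i) \<inter> S"
      by blast
  qed
  show ?thesis
    unfolding krull_dim_def
  proof (intro Sup_upper CollectI exI conjI)
    show "\<forall>i\<le>d. irreducible_closedin (subtopology (zariski_topology s V) S) (L i \<inter> S)"
      using irr by simp
    show "\<forall>i<d. L i \<inter> S \<subset> L (Suc i) \<inter> S"
      using less by simp
  qed simp
qed

lemma (in dual_basis) krull_dim_ge_card:
  assumes h: "poly_function_on s V h" and p: "p \<in> V" "h p \<noteq> 0"
    and S: "\<And>x. x \<in> V \<Longrightarrow> h x \<noteq> 0 \<Longrightarrow> x \<in> S"
  shows "ereal (real (card I)) \<le> krull_dim (subtopology (zariski_topology s V) S)"
proof -
  obtain g where g: "bij_betw g {..<card I} I"
    using ex_bij_betw_nat_finite[OF finite_index] by (auto simp: lessThan_atLeast0)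
  have gI: "g i \<in> I" if "i < card I" for i
    using g that bij_betwE by blast
  have gi: "g i = g j \<longleftrightarrow> i = j" if "i < card I" "j < card I" for i j
    using bij_betw_imp_inj_on[OF g] that by (auto simp: inj_on_def)
  show ?thesis
  proof (rule krull_dim_ge_open[OF vector_space_axioms subspace h p S])
    show "linear_functional_on s V (f (g i))" if "i < card I" for i
      by (rule linear[OF gI[OF that]])
    show "e (g i) \<in> V" if "i < card I" for i
      by (rule basis_in[OF gI[OF that]])
    show "f (g i) (e (g j)) = of_bool (i = j)" if "i < card I" "j < card I" for i j
      using that by (simp add: dual gI gi)
  qed
qed

lemma krull_dim_empty: "krull_dim (subtopology X {}) = - \<infinity>"
proof -
  have "\<not> irreducible_closedin (subtopology X {}) Z" for Z
    unfolding irreducible_closedin_def using closedin_subset[of "subtopology X {}" Z] by auto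
  then have "{ereal (real d) | d. \<exists>Z. (\<forall>i\<le>d. irreducible_closedin (subtopology X {}) (Z i)) \<and>
      (\<forall>i<d. Z i \<subset> Z (Suc i))} = {}"
    by blast
  then show ?thesis
    unfolding krull_dim_def by (simp only:) (simp add: bot_ereal_def)
qed


section \<open>Coordinates on currents\<close>

lemma coeff_trunc: "coeff (trunc n p) m = (if m < n then coeff p m else 0)"
proof (cases "m < n")
  case True
  have "monom 1 n dvd p - trunc n p"
    unfolding trunc_def by (simp add: minus_mod_eq_mult_div)
  then show ?thesis
    using True by (simp add: monom_1_dvd_iff')
next
  case False
  have "trunc n p = 0 \<or> degree (trunc n p) < n"
    unfolding trunc_def using degree_mod_less[of "monom 1 n" p] by (auto simp: degree_monom_eq)
  then show ?thesis
    using False by (auto intro: coeff_eq_0)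
qed

lemma trunc_eq_0_iff: "trunc n p = 0 \<longleftrightarrow> monom 1 n dvd p"
  by (simp add: trunc_def mod_eq_0_iff_dvd)

lemma trunc_eq_self_iff: "trunc n p = p \<longleftrightarrow> (\<forall>m\<ge>n. coeff p m = 0)"
  by (auto simp: poly_eq_iff coeff_trunc not_less)

lemma trunc_eqI: "trunc n p = p \<Longrightarrow> monom 1 n dvd q - p \<Longrightarrow> trunc n q = p"
  by (metis trunc_eq_0_iff trunc_diff eq_iff_diff_eq_0)

lemma monom_dvd_unit_multD:
  fixes u q :: "'a::idom poly"
  assumes u: "coeff u 0 \<noteq> 0" and dvd: "monom 1 n dvd u * q"
  shows "monom 1 n dvd q"
  unfolding monom_1_dvd_iff'
proof (intro allI)
  fix k
  show "k < n \<longrightarrow> coeff q k = 0"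
  proof (induction k rule: less_induct)
    case (less k)
    show ?case
    proof
      assume k: "k < n"
      have "(\<Sum>i\<le>k. coeff u i * coeff q (k - i)) = (\<Sum>i\<in>{0}. coeff u i * coeff q (k - i))"
        using less k by (intro sum.mono_neutral_right) auto
      moreover have "coeff (u * q) k = 0"
        using dvd k by (simp add: monom_1_dvd_iff')
      ultimately show "coeff q k = 0"
        using u by (simp add: coeff_mult)
    qed
  qed
qed

text \<open>An inverse modulo \<open>z^n\<close> is improved to one modulo \<open>z^(n+1)\<close> by
  a correction of the form \<open>c z^n\<close>.\<close>

lemma exists_inverse_mod_monom:
  fixes u :: "'a::field poly"
  assumes "coeff u 0 \<noteq> 0"
  shows "\<exists>w. monom 1 n dvd u * w - 1"
proof (induction n)
  case 0
  then show ?case by (simp add: monom_0 one_pCons[symmetric])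
next
  case (Suc n)
  then obtain w q where w: "u * w - 1 = monom 1 n * q" by auto
  \<comment> \<open>This value cancels the constant term of \<open>q - smult c u\<close>, which
    gains one more factor \<open>z\<close>.\<close>
  define c where "c = coeff q 0 / coeff u 0"
  have "u * (w - monom 1 n * [:c:]) - 1 = (u * w - 1) - monom 1 n * (u * [:c:])"
    by (simp add: algebra_simps)
  also have "\<dots> = monom 1 n * (q - smult c u)"
    unfolding w by (simp add: algebra_simps)
  finally have eq: "u * (w - monom 1 n * [:c:]) - 1 = monom 1 n * (q - smult c u)" .
  have "monom 1 1 dvd q - smult c u"
    using assms by (simp add: monom_1_dvd_iff' c_def)
  then have "monom 1 n * monom 1 1 dvd monom 1 n * (q - smult c u)"
    by (rule mult_dvd_mono[OF dvd_refl])
  then have "monom 1 (Suc n) dvd u * (w - monom 1 n * [:c:]) - 1"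
    unfolding eq by (simp add: mult_monom)
  then show ?case ..
qed

text \<open>\<open>c\<close> is the least order of vanishing in the family, capped at
  \<open>N\<close>; the cap is reached when all members vanish modulo \<open>z^N\<close>.\<close>

lemma exists_common_order:
  fixes q :: "'k \<Rightarrow> 'a::idom poly"
  shows "\<exists>c\<le>N. (\<forall>j\<in>J. monom 1 c dvd q j) \<and> (c < N \<longrightarrow> (\<exists>j\<in>J. coeff (q j) c \<noteq> 0))"
proof (cases "\<exists>c<N. \<exists>j\<in>J. coeff (q j) c \<noteq> 0")
  case True
  define P where "P c \<longleftrightarrow> c < N \<and> (\<exists>j\<in>J. coeff (q j) c \<noteq> 0)" for c
  define c where "c = (LEAST c. P c)"
  have "\<exists>c. P c"
    using True by (auto simp: P_def)
  then have c: "c < N" "\<exists>j\<in>J. coeff (q j) c \<noteq> 0"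
    using LeastI_ex[of P, folded c_def] unfolding P_def by blast+
  have "coeff (q j) k = 0" if "j \<in> J" "k < c" for j k
    using not_less_Least[of k P, folded c_def] that c(1) by (auto simp: P_def)
  then show ?thesis
    using c by (intro exI[of _ c]) (simp add: monom_1_dvd_iff')
next
  case False
  then show ?thesis
    by (intro exI[of _ N]) (auto simp: monom_1_dvd_iff')
qed

lemma monom_mult_poly_shift: "monom 1 n dvd p \<Longrightarrow> monom 1 n * poly_shift n p = p"
  by (auto simp: poly_eq_iff coeff_monom_mult coeff_poly_shift monom_1_dvd_iff')

section \<open>Coordinates on the Lie algebra\<close>

lemma linear_functional_on_entry_mat: "linear_functional_on scale_mat V (\<lambda>A. coeff (A $ i $ j) m)"
  by (simp add: linear_functional_on_def scale_mat_def)

text \<open>The entry \<open>(2, 2)\<close> is determined by tracelessness, so it is no coordinate;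
  accordingly the vector dual to \<open>((1, 1), m)\<close> is the diagonal matrix with entries
  \<open>z^m\<close> and \<open>- z^m\<close>.\<close>

interpretation current_sl2: dual_basis scale_mat "current_sl2 n" "{(1, 1), (1, 2), (2, 1)} \<times> {..<n}"
  "\<lambda>((i, j), m) A. coeff (A $ i $ j) m"
  "\<lambda>((k, l), m). \<chi> i j. if i = k \<and> j = l then monom 1 m
     else if k = 1 \<and> l = 1 \<and> i = 2 \<and> j = 2 then - monom 1 m else 0"
proof unfold_locales
  show "scale_mat.subspace (current_sl2 n)"
    by (rule subspace_current_sl2)
  show "finite ({(1, 1), (1, 2), (2, 1)} \<times> {..<n})"
    by simp
next
  fix x :: "complex poly^2^2"
  assume x: "x \<in> current_sl2 n"
    and zero: "\<forall>\<kappa>\<in>{(1, 1), (1, 2), (2, 1)} \<times> {..<n}. (case \<kappa> of (x, xa) \<Rightarrow> (case x of (i, j) \<Rightarrow> \<lambda>m A. coeff (A $ i $ j) m) xa) x = 0"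
  have "trunc n (x $ i $ j) = x $ i $ j" for i j
    using x by (simp add: current_sl2_def trunc_mat_def vec_eq_iff)
  then have "coeff (x $ i $ j) m = 0" if "m \<ge> n" for i j m
    using that by (simp add: trunc_eq_self_iff)
  then have "x $ i $ j = 0" if "(i, j) \<in> {(1, 1), (1, 2), (2, 1)}" for i j
    using zero that by (fastforce simp: poly_eq_iff not_less[symmetric])
  moreover have "x $ 1 $ 1 + x $ 2 $ 2 = 0"
    using x by (simp add: current_sl2_def trace_def sum_2)
  ultimately show "x = 0"
    by (simp add: vec_eq_iff forall_2)
qed (auto simp: linear_functional_on_entry_mat current_sl2_def trunc_mat_def trace_def sum_2 vec_eq_iff
    forall_2 trunc_eq_self_iff split: if_splits)

lemma dim_current_sl2: "scale_mat.dim (current_sl2 n) = 3 * n"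
  by (simp add: current_sl2.dim_eq_card card_cartesian_product)

section \<open>Module elements as matrices of polynomials, and the annihilator equations\<close>

definition entry :: "(complex^'r \<Rightarrow> complex poly^2) \<Rightarrow> 2 \<Rightarrow> 'r \<Rightarrow> complex poly" where
  "entry x i j = x (axis j 1) $ i"

definition hom_of :: "(2 \<Rightarrow> 'r \<Rightarrow> complex poly) \<Rightarrow> (complex^'r::finite \<Rightarrow> complex poly^2)" where
  "hom_of p = (\<lambda>w. \<chi> i. \<Sum>j\<in>UNIV. smult (w $ j) (p i j))"

lemma entry_hom_of [simp]: "entry (hom_of p) i j = p i j"
proof -
  have "(\<Sum>k\<in>UNIV. smult (axis j 1 $ k) (p i k)) = (\<Sum>k\<in>UNIV. if k = j then p i k else 0)"
    by (intro sum.cong) (auto simp: axis_def)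
  then show ?thesis
    by (simp add: entry_def hom_of_def)
qed

lemma hom_of_entry:
  assumes "x \<in> hom_current n"
  shows "hom_of (entry x) = x"
proof
  fix w :: "complex^'a"
  interpret Vector_Spaces.linear "(*s)" scale_vec x
    using assms by (simp add: hom_current_def)
  have "x w = x (\<Sum>j\<in>UNIV. w $ j *s axis j 1)"
    by (simp add: basis_expansion)
  also have "\<dots> = (\<Sum>j\<in>UNIV. scale_vec (w $ j) (x (axis j 1)))"
    by (simp add: sum scale)
  finally show "hom_of (entry x) w = x w"
    by (simp add: hom_of_def entry_def vec_eq_iff scale_vec_def)
qed

lemma hom_of_in:
  assumes "\<And>i j. trunc n (p i j) = p i j"
  shows "hom_of p \<in> hom_current n"
proof -
  have "trunc n (\<Sum>j\<in>UNIV. smult (w $ j) (p i j)) = (\<Sum>j\<in>UNIV. smult (w $ j) (p i j))" for w i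
    using assms by (simp add: trunc_eq_self_iff coeff_sum)
  moreover have "(\<Sum>j\<in>UNIV. smult (c * w $ j) (p i j)) = smult c (\<Sum>j\<in>UNIV. smult (w $ j) (p i j))" for c w i
    by (simp add: poly_eq_iff coeff_sum sum_distrib_left mult.assoc)
  ultimately show ?thesis
    by (auto simp: hom_current_def linear_hom_iff hom_of_def current_vec_def trunc_vec_def scale_vec_def
        vec_eq_iff smult_add_left sum.distrib)
qed

lemma trunc_entry: "x \<in> hom_current n \<Longrightarrow> trunc n (entry x i j) = entry x i j"
  by (auto simp: hom_current_def current_vec_def trunc_vec_def entry_def vec_eq_iff image_subset_iff)

lemma linear_functional_on_entry: "linear_functional_on hom_scale V (\<lambda>x. coeff (entry x i j) m)"
  by (simp add: linear_functional_on_def hom_scale_def scale_vec_def entry_def)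

interpretation hom_current: dual_basis hom_scale
  "hom_current n :: (complex^'r::finite \<Rightarrow> complex poly^2) set" "UNIV \<times> {..<n}"
  "\<lambda>((i, j), m) x. coeff (entry x i j) m"
  "\<lambda>((k, l), m). hom_of (\<lambda>i j. if i = k \<and> j = l then monom 1 m else 0)"
proof unfold_locales
  show "hom_scale.subspace (hom_current n :: (complex^'r \<Rightarrow> complex poly^2) set)"
    by (rule subspace_hom_current)
  show "finite (UNIV \<times> {..<n} :: ((2 \<times> 'r) \<times> nat) set)"
    by simp
next
  fix x :: "complex^'r \<Rightarrow> complex poly^2"
  assume x: "x \<in> hom_current n"
    and zero: "\<forall>\<kappa>\<in>UNIV \<times> {..<n}. (case \<kappa> of (x, xa) \<Rightarrow> (case x of (i, j) \<Rightarrow> \<lambda>m x. coeff (entry x i j) m) xa) x = 0"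
  have "coeff (entry x i j) m = 0" if "m \<ge> n" for i j m
    using trunc_entry[OF x] that by (simp add: trunc_eq_self_iff)
  then have "entry x i j = 0" for i j
    using zero by (fastforce simp: poly_eq_iff not_less[symmetric])
  then have "hom_of (entry x) = 0"
    by (simp add: hom_of_def fun_eq_iff vec_eq_iff)
  then show "x = 0"
    by (simp add: hom_of_entry[OF x])
qed (auto simp: linear_functional_on_entry trunc_eq_self_iff intro!: hom_of_in split: if_splits)

lemma subspace_annihilator: "scale_mat.subspace (annihilator (current_sl2 n) (hom_act n) x)"
proof -
  have "hom_act n (A + B) x = hom_act n A x + hom_act n B x" for A B
    by (simp add: hom_act_def current_act_def matrix_vector_mult_add_rdistrib trunc_vec_def vec_eq_iff
        trunc_add fun_eq_iff)
  moreover have "hom_act n (scale_mat c A) x = hom_scale c (hom_act n A x)" for c A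
    by (simp add: hom_act_def current_act_def hom_scale_def scale_vec_def scale_mat_def trunc_vec_def
        vec_eq_iff fun_eq_iff matrix_vector_mult_def sum_2 smult_add_right trunc_add trunc_smult)
  moreover have "hom_act n 0 x = 0"
    by (simp add: hom_act_def current_act_def trunc_vec_def vec_eq_iff fun_eq_iff)
  ultimately show ?thesis
    using subspace_current_sl2[of n]
    by (simp add: scale_mat.subspace_def annihilator_def)
qed

lemma annihilator_dvd:
  assumes "A \<in> annihilator (current_sl2 n) (hom_act n) x"
  shows "monom 1 n dvd A $ i $ 1 * entry x 1 j + A $ i $ 2 * entry x 2 j"
proof -
  have "trunc_vec n (A *v x (axis j 1)) $ i = 0"
    using assms by (simp add: annihilator_def hom_act_def current_act_def fun_eq_iff)
  then show ?thesis
    by (simp add: trunc_vec_def matrix_vector_mult_def sum_2 entry_def trunc_eq_0_iff)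
qed


section \<open>Parametrization by invariant factors\<close>

lemma monom_dvd_monom_mult_iff:
  fixes p :: "'a::idom poly"
  assumes "a \<le> n"
  shows "monom 1 n dvd monom 1 a * p \<longleftrightarrow> monom 1 (n - a) dvd p"
proof -
  have "monom 1 n = monom 1 a * monom (1::'a) (n - a)"
    using assms by (simp add: mult_monom)
  then show ?thesis
    by (simp add: monom_eq_0_iff)
qed

lemma exhaust_2_distinct:
  fixes i0 i1 :: 2
  assumes "i0 \<noteq> i1"
  shows "i0 = 1 \<and> i1 = 2 \<or> i0 = 2 \<and> i1 = 1"
  using assms exhaust_2[of i0] exhaust_2[of i1] by auto

text \<open>Something killed by \<open>z^c\<close> modulo \<open>z^n\<close> is determined there by
  its top \<open>c\<close> coefficients. This leaves \<open>b\<close> numbers for the entry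
  \<open>(i0, i1)\<close> of \<open>A\<close> and \<open>a\<close> numbers for each of the two
  entries of \<open>A v\<close>. They determine \<open>A\<close>: when all vanish, the unit
  \<open>v i0\<close> and tracelessness clear the remaining entries one after another.\<close>

lemma dim_le_torsion:
  fixes v :: "2 \<Rightarrow> complex poly"
  assumes i: "i0 \<noteq> i1" and W: "scale_mat.subspace W" "W \<subseteq> current_sl2 n"
    and v: "coeff (v i0) 0 \<noteq> 0" and ab: "a \<le> n" "b \<le> n"
    and h1: "\<And>A. A \<in> W \<Longrightarrow> monom 1 n dvd monom 1 b * A $ i0 $ i1"
    and h2: "\<And>A i. A \<in> W \<Longrightarrow> monom 1 n dvd monom 1 a * (A $ i $ i0 * v i0 + A $ i $ i1 * v i1)"
  shows "scale_mat.dim W \<le> 2 * a + b"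
proof -
  \<comment> \<open>The tag \<open>0\<close> selects the entry \<open>(i0, i1)\<close>, the tags
    \<open>1\<close> and \<open>2\<close> the rows \<open>i0\<close> and \<open>i1\<close> of
    \<open>A v\<close>.\<close>
  define F :: "nat \<times> nat \<Rightarrow> complex poly^2^2 \<Rightarrow> complex" where
    "F = (\<lambda>(k, m) A. coeff (if k = 0 then A $ i0 $ i1 else if k = 1 then A $ i0 $ i0 * v i0 + A $ i0 $ i1 * v i1
       else A $ i1 $ i0 * v i0 + A $ i1 $ i1 * v i1) m)"
  define J :: "(nat \<times> nat) set" where "J = {0} \<times> {n - b..<n} \<union> {1, 2} \<times> {n - a..<n}"
  have "scale_mat.dim W \<le> card J"
  proof (rule dim_le_card_functionals[OF vector_space_scale_mat W(1)])
    show "finite J"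
      by (simp add: J_def)
    show "linear_functional_on scale_mat W (F i)" for i
      by (auto simp: linear_functional_on_def scale_mat_def F_def distrib_left distrib_right split: prod.splits)
  next
    fix A assume A: "A \<in> W" and zero: "\<forall>i\<in>J. F i A = 0"
    have "A \<in> current_sl2 n"
      using A W(2) by blast
    then have tr: "A $ i0 $ i0 + A $ i1 $ i1 = 0" and cut: "\<And>i j. trunc n (A $ i $ j) = A $ i $ j"
      using exhaust_2_distinct[OF i]
      by (auto simp: current_sl2_def trunc_mat_def vec_eq_iff trace_def sum_2 add.commute)
    have eq0: "A $ i $ j = 0" if "monom 1 n dvd A $ i $ j" for i j
      using that cut[of i j] trunc_eq_0_iff[of n "A $ i $ j"] by simp
    have z0: "coeff (A $ i0 $ i1) m = 0" if "n - b \<le> m" "m < n" for m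
      using bspec[OF zero, of "(0, m)"] that by (simp add: J_def F_def)
    have z1: "coeff (A $ i0 $ i0 * v i0 + A $ i0 $ i1 * v i1) m = 0" if "n - a \<le> m" "m < n" for m
      using bspec[OF zero, of "(1, m)"] that by (simp add: J_def F_def)
    have z2: "coeff (A $ i1 $ i0 * v i0 + A $ i1 $ i1 * v i1) m = 0" if "n - a \<le> m" "m < n" for m
      using bspec[OF zero, of "(2, m)"] that by (simp add: J_def F_def)
    have fill: "monom 1 n dvd p"
      if "monom 1 n dvd monom 1 c * p" "c \<le> n" "\<And>m. n - c \<le> m \<Longrightarrow> m < n \<Longrightarrow> coeff p m = 0"
      for c and p :: "complex poly"
    proof -
      have "monom 1 (n - c) dvd p"
        using that(1) monom_dvd_monom_mult_iff[OF that(2)] by blast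
      then have "coeff p k = 0" if "k < n" for k
        using \<open>\<And>m. n - c \<le> m \<Longrightarrow> m < n \<Longrightarrow> coeff p m = 0\<close>[of k] that
        by (cases "k < n - c") (auto simp: monom_1_dvd_iff')
      then show ?thesis
        by (simp add: monom_1_dvd_iff')
    qed
    have A01: "A $ i0 $ i1 = 0"
      using fill[OF h1[OF A] ab(2)] z0 by (intro eq0) simp
    have "monom 1 n dvd A $ i0 $ i0 * v i0 + A $ i0 $ i1 * v i1"
      using fill[OF h2[OF A, of i0] ab(1)] z1 by simp
    then have "monom 1 n dvd v i0 * A $ i0 $ i0"
      using A01 by (simp add: mult.commute)
    then have A00: "A $ i0 $ i0 = 0"
      by (rule eq0[OF monom_dvd_unit_multD[OF v]])
    have A11: "A $ i1 $ i1 = 0"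
      using tr A00 by simp
    have "monom 1 n dvd A $ i1 $ i0 * v i0 + A $ i1 $ i1 * v i1"
      using fill[OF h2[OF A, of i1] ab(1)] z2 by simp
    then have "monom 1 n dvd v i0 * A $ i1 $ i0"
      using A11 by (simp add: mult.commute)
    then have A10: "A $ i1 $ i0 = 0"
      by (rule eq0[OF monom_dvd_unit_multD[OF v]])
    show "A = 0"
      using exhaust_2_distinct[OF i] A00 A01 A10 A11 by (auto simp: vec_eq_iff forall_2)
  qed
  also have "card J \<le> 2 * a + b"
  proof -
    have "card J \<le> card ({0::nat} \<times> {n - b..<n}) + card ({1, 2::nat} \<times> {n - a..<n})"
      unfolding J_def by (rule card_Un_le)
    also have "\<dots> = 2 * a + b"
      using ab by (simp add: card_cartesian_product)
    finally show ?thesis .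
  qed
  finally show ?thesis .
qed

section \<open>The parametrizing maps and their numbers of parameters\<close>

definition param_bound :: "nat \<Rightarrow> nat \<Rightarrow> nat \<Rightarrow> 2 \<Rightarrow> 'r \<Rightarrow> 2 \<Rightarrow> 'r \<Rightarrow> nat" where
  "param_bound n a b i0 j0 i j = (if i = i0 \<or> j = j0 then n - a else n - b)"

definition param_poly :: "nat \<Rightarrow> nat \<Rightarrow> nat \<Rightarrow> 2 \<Rightarrow> 'r \<Rightarrow> ((2 \<times> 'r) \<times> nat \<Rightarrow> complex) \<Rightarrow> 2 \<Rightarrow> 'r \<Rightarrow> complex poly" where
  "param_poly n a b i0 j0 t i j = (\<Sum>m<param_bound n a b i0 j0 i j. monom (t ((i, j), m)) m)"

definition param_index :: "nat \<Rightarrow> nat \<Rightarrow> nat \<Rightarrow> 2 \<Rightarrow> 'r \<Rightarrow> ((2 \<times> 'r) \<times> nat) set" where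
  "param_index n a b i0 j0 = (SIGMA \<kappa>:UNIV. {..<param_bound n a b i0 j0 (fst \<kappa>) (snd \<kappa>)})"

text \<open>Only column \<open>j0\<close> of the parameters holds a column of the matrix, up to
  \<open>z^a\<close>. For another \<open>j\<close>, row \<open>i0\<close> holds the multiplier of
  that column and the other row holds the remainder, which is scaled by \<open>z^(b-a)\<close> and
  hence matters only modulo \<open>z^(n-b)\<close>.\<close>

definition param_hom ::
    "nat \<Rightarrow> nat \<Rightarrow> nat \<Rightarrow> 2 \<Rightarrow> 'r::finite \<Rightarrow> ((2 \<times> 'r) \<times> nat \<Rightarrow> complex) \<Rightarrow> (complex^'r \<Rightarrow> complex poly^2)" where
  "param_hom n a b i0 j0 t = hom_of (\<lambda>i j. trunc n (monom 1 a *
     (if j = j0 then param_poly n a b i0 j0 t i j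
      else param_poly n a b i0 j0 t i0 j * param_poly n a b i0 j0 t i j0 +
        (if i = i0 then 0 else monom 1 (b - a) * param_poly n a b i0 j0 t i j))))"

lemma coeff_param_poly:
  "coeff (param_poly n a b i0 j0 t i j) m = (if m < param_bound n a b i0 j0 i j then t ((i, j), m) else 0)"
  by (simp add: param_poly_def coeff_sum)

lemma param_poly_coeff:
  assumes "\<And>m. m \<ge> param_bound n a b i0 j0 i j \<Longrightarrow> coeff (p i j) m = 0"
  shows "param_poly n a b i0 j0 (\<lambda>((i, j), m). coeff (p i j) m) i j = p i j"
  using assms by (auto simp: poly_eq_iff coeff_param_poly not_less)

lemma param_hom_in: "param_hom n a b i0 j0 t \<in> hom_current n"
  unfolding param_hom_def by (rule hom_of_in) simp

lemma finite_param_index: "finite (param_index n a b i0 (j0 :: 'r::finite))"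
  unfolding param_index_def by auto

lemma card_param_index:
  fixes j0 :: "'r::finite"
  shows "card (param_index n a b i0 j0) = (CARD('r) + 1) * (n - a) + (CARD('r) - 1) * (n - b)"
proof -
  define i1 :: 2 where "i1 = (if i0 = 1 then 2 else 1)"
  have i1: "i1 \<noteq> i0" "(UNIV :: 2 set) = {i0, i1}"
    using exhaust_2[of i0] by (auto simp: UNIV_2 i1_def)
  have "card (param_index n a b i0 j0) = (\<Sum>\<kappa>\<in>UNIV. param_bound n a b i0 j0 (fst \<kappa>) (snd \<kappa>))"
    unfolding param_index_def by (subst card_SigmaI) auto
  also have "\<dots> = (\<Sum>i\<in>UNIV. \<Sum>j\<in>UNIV. param_bound n a b i0 j0 i j)"
    by (simp add: sum.cartesian_product case_prod_unfold)
  also have "\<dots> = (\<Sum>j\<in>UNIV. param_bound n a b i0 j0 i0 j) + (\<Sum>j\<in>UNIV. param_bound n a b i0 j0 i1 j)"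
    unfolding i1(2) using i1(1) by simp
  also have "(\<Sum>j\<in>UNIV. param_bound n a b i0 j0 i0 j) = CARD('r) * (n - a)"
    by (simp add: param_bound_def)
  also have "(\<Sum>j\<in>UNIV. param_bound n a b i0 j0 i1 j) =
      param_bound n a b i0 j0 i1 j0 + (\<Sum>j\<in>UNIV - {j0}. param_bound n a b i0 j0 i1 j)"
    by (rule sum.remove) auto
  also have "(\<Sum>j\<in>UNIV - {j0}. param_bound n a b i0 j0 i1 j) = (\<Sum>j\<in>UNIV - {j0}. n - b)"
    using i1 by (intro sum.cong) (auto simp: param_bound_def)
  finally show ?thesis
    by (simp add: param_bound_def)
qed

text \<open>With \<open>r = CARD('r)\<close>, the count is
  \<open>2rn - (r + 1) a - (r - 1) b\<close>, and \<open>r + 1\<close> is at least \<open>2\<close>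
  while \<open>r - 1\<close> is at least \<open>1\<close>.\<close>

lemma card_param_index_le:
  fixes j0 :: "'r::finite"
  assumes r: "CARD('r) \<ge> 2" and "a \<le> n" "b \<le> n" "k \<le> 2 * a + b"
  shows "card (param_index n a b i0 j0) \<le> 2 * CARD('r) * n - k"
proof -
  obtain M where M: "CARD('r) = M + 2"
    using r by (metis add.commute le_Suc_ex)
  obtain A B where A: "n = a + A" and B: "n = b + B"
    using assms by (metis le_Suc_ex)
  have "2 * (M + 2) * n = (M + 3) * (a + A) + (M + 1) * (b + B)"
    unfolding A[symmetric] B[symmetric] by (simp add: algebra_simps)
  then have "(M + 3) * A + (M + 1) * B + k \<le> 2 * (M + 2) * n"
    using assms(4) by (simp add: algebra_simps)
  moreover have "n - a = A" "n - b = B"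
    using A B by simp_all
  ultimately show ?thesis
    unfolding card_param_index M by (simp add: add_mult_distrib)
qed

text \<open>Coefficients of sums and products are polynomial in the coefficients of the operands,
  and truncation only discards coefficients.\<close>

lemma poly_param_param_hom:
  fixes j0 :: "'r::finite"
  assumes f: "poly_function_on hom_scale (hom_current n) f"
  shows "poly_param (param_index n a b i0 j0) (\<lambda>t. f (param_hom n a b i0 j0 t))"
proof (rule hom_current.poly_param_comp[OF f param_hom_in])
  let ?I = "param_index n a b i0 j0"
  let ?P = "\<lambda>t. param_poly n a b i0 j0 t"
  have coord: "poly_param ?I (\<lambda>t. coeff (?P t i j) m)" for i j m
  proof (cases "m < param_bound n a b i0 j0 i j")
    case True
    then show ?thesis
      unfolding coeff_param_poly
      using poly_param_var[OF finite_param_index, of "((i, j), m)" n a b i0 j0] by (simp add: param_index_def)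
  next
    case False
    then show ?thesis
      unfolding coeff_param_poly by (simp add: poly_param_const)
  qed
  have mult: "poly_param ?I (\<lambda>t. coeff (p t * q t) m)"
    if "\<And>m. poly_param ?I (\<lambda>t. coeff (p t) m)" "\<And>m. poly_param ?I (\<lambda>t. coeff (q t) m)" for p q m
    unfolding coeff_mult by (intro poly_param_sum poly_param_mult that)
  have add: "poly_param ?I (\<lambda>t. coeff (p t + q t) m)"
    if "\<And>m. poly_param ?I (\<lambda>t. coeff (p t) m)" "\<And>m. poly_param ?I (\<lambda>t. coeff (q t) m)" for p q m
    unfolding coeff_add by (intro poly_param_add that)
  have const: "poly_param ?I (\<lambda>t. coeff p m)" for p m
    by (rule poly_param_const)
  fix \<kappa> :: "(2 \<times> 'r) \<times> nat" assume "\<kappa> \<in> UNIV \<times> {..<n}"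
  then obtain i j m where \<kappa>: "\<kappa> = ((i, j), m)" "m < n"
    by (cases \<kappa>) auto
  have "poly_param ?I (\<lambda>t. coeff (monom 1 a * ?P t i j) m)"
    by (intro mult const coord)
  \<comment> \<open>The three shapes are those of an entry in column \<open>j0\<close>, elsewhere in
    row \<open>i0\<close>, and elsewhere in the other row; \<open>+ 0\<close> reproduces the
    vanishing branch in row \<open>i0\<close>.\<close>
  moreover have "poly_param ?I (\<lambda>t. coeff (monom 1 a * (?P t i0 j * ?P t i j0 + 0)) m)"
    by (intro add mult const coord)
  moreover have "poly_param ?I (\<lambda>t. coeff (monom 1 a * (?P t i0 j * ?P t i j0 + monom 1 (b - a) * ?P t i j)) m)"
    by (intro add mult const coord)
  ultimately show "poly_param ?I (\<lambda>t. (case \<kappa> of (x, xa) \<Rightarrow> (case x of (i, j) \<Rightarrow> \<lambda>m x. coeff (entry x i j) m) xa)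
      (param_hom n a b i0 j0 t))"
    using \<kappa> by (cases "j = j0"; cases "i = i0") (simp_all add: param_hom_def coeff_trunc)
qed

lemma hom_current_eqI:
  assumes "x \<in> hom_current n" "y \<in> hom_current n" "\<And>i j. entry x i j = entry y i j"
  shows "x = y"
proof -
  have "hom_of (entry x) = hom_of (entry y)"
    using assms(3) by (simp add: hom_of_def)
  then show ?thesis
    using assms by (simp add: hom_of_entry)
qed

lemma annihilator_dvd_distinct:
  assumes "A \<in> annihilator (current_sl2 n) (hom_act n) x" and i: "i0 \<noteq> i1"
  shows "monom 1 n dvd A $ i $ i0 * entry x i0 j + A $ i $ i1 * entry x i1 j"
  using exhaust_2_distinct[OF i] annihilator_dvd[OF assms(1), of i j] by (auto simp: add.commute)

text \<open>After extracting the common order \<open>a\<close>, some column \<open>v\<close> is primitive with unit entry in row \<open>i0\<close>. Every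
  other column is \<open>\<lambda>\<^sub>j v + z\<^sup>b\<^sup>-\<^sup>a \<mu>\<^sub>j e\<close> with \<open>e\<close> the basis vector of the other row, and \<open>b\<close> is maximal.\<close>
lemma exists_param_hom:
  fixes x :: "complex^'r::finite \<Rightarrow> complex poly^2"
  assumes x: "x \<in> hom_current n"
  shows "\<exists>a b i0 j0 t. a \<le> n \<and> b \<le> n \<and> x = param_hom n a b i0 j0 t \<and>
     scale_mat.dim (annihilator (current_sl2 n) (hom_act n) x) \<le> 2 * a + b"
proof -
  define W where "W = annihilator (current_sl2 n) (hom_act n) x"
  have W: "scale_mat.subspace W" "W \<subseteq> current_sl2 n"
    unfolding W_def by (rule subspace_annihilator) (auto simp: annihilator_def)
  define X where "X = entry x"
  have cutX: "trunc n (X i j) = X i j" for i j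
    unfolding X_def by (rule trunc_entry[OF x])
  have "\<exists>a\<le>n. (\<forall>\<kappa>\<in>UNIV. monom 1 a dvd (\<lambda>(i, j). X i j) \<kappa>) \<and>
      (a < n \<longrightarrow> (\<exists>\<kappa>\<in>UNIV. coeff ((\<lambda>(i, j). X i j) \<kappa>) a \<noteq> 0))"
    by (rule exists_common_order)
  then obtain a where a: "a \<le> n" and dvdX: "\<And>i j. monom 1 a dvd X i j"
    and unitX: "a < n \<Longrightarrow> \<exists>i j. coeff (X i j) a \<noteq> 0"
    by auto
  show ?thesis
  proof (cases "a < n")
    case False
    then have "X i j = 0" for i j
      using a dvdX[of i j] cutX[of i j] trunc_eq_0_iff[of n "X i j"] by simp
    then have "x = param_hom n n n 1 undefined (\<lambda>_. 0)"
      by (intro hom_current_eqI[OF x param_hom_in]) (simp add: param_hom_def X_def trunc_eq_0_iff)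
    \<comment> \<open>For \<open>x = 0\<close> the torsion conditions with \<open>a = b = n\<close>
      are trivial, and the constant \<open>1\<close> serves as the unit column.\<close>
    moreover have "scale_mat.dim W \<le> 2 * n + n"
      by (rule dim_le_torsion[of 1 2 W n "\<lambda>_. 1"]) (use W in auto)
    ultimately show ?thesis
      unfolding W_def by (intro exI[of _ n] exI[of _ 1] exI[of _ undefined] exI[of _ "\<lambda>_. 0"]) simp
  next
    case True
    then obtain i0 j0 where ij0: "coeff (X i0 j0) a \<noteq> 0"
      using unitX by blast
    define i1 :: 2 where "i1 = (if i0 = 1 then 2 else 1)"
    have i01: "i0 \<noteq> i1"
      using exhaust_2[of i0] by (auto simp: i1_def)
    have i_cases: "i = i0 \<or> i = i1" for i
      using exhaust_2[of i] exhaust_2_distinct[OF i01] by auto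
    define Y where "Y i j = poly_shift a (X i j)" for i j
    have XY: "X i j = monom 1 a * Y i j" for i j
      unfolding Y_def using monom_mult_poly_shift[OF dvdX] by simp
    have degY: "coeff (Y i j) m = 0" if "m \<ge> n - a" for i j m
      using cutX[of i j] that a by (simp add: Y_def coeff_poly_shift trunc_eq_self_iff)
    define u where "u = Y i0 j0"
    have u: "coeff u 0 \<noteq> 0"
      using ij0 by (simp add: u_def Y_def coeff_poly_shift)
    obtain w where w: "monom 1 (n - a) dvd u * w - 1"
      using exists_inverse_mod_monom[OF u] by blast
    \<comment> \<open>\<open>L j\<close> is the quotient of \<open>Y i0 j\<close> by the unit
      \<open>u\<close> modulo \<open>z^(n-a)\<close>: the multiple of column \<open>j0\<close> that
      agrees with column \<open>j\<close> in row \<open>i0\<close>. \<open>Q j\<close> is what is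
      left in row \<open>i1\<close>.\<close>
    define L where "L j = trunc (n - a) (Y i0 j * w)" for j
    define Q where "Q j = trunc (n - a) (Y i1 j - L j * Y i1 j0)" for j
    have trunc_dvd: "monom 1 k dvd p - trunc k p" for k p
      by (simp add: trunc_def minus_mod_eq_mult_div)
    have e0: "monom 1 (n - a) dvd Y i0 j - L j * u" for j
    proof -
      have "Y i0 j - L j * u = (Y i0 j * w - L j) * u - Y i0 j * (u * w - 1)"
        by (simp add: algebra_simps)
      moreover have "monom 1 (n - a) dvd (Y i0 j * w - L j) * u"
        unfolding L_def by (intro dvd_mult2 trunc_dvd)
      moreover have "monom 1 (n - a) dvd Y i0 j * (u * w - 1)"
        by (intro dvd_mult w)
      ultimately show ?thesis
        by (simp add: dvd_diff)
    qed
    \<comment> \<open>The common order of the remainders gives the second invariant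
      \<open>b = a + c\<close>; if all remainders vanish, \<open>c = n - a\<close> and
      \<open>b = n\<close>.\<close>
    have "\<exists>c\<le>n - a. (\<forall>j\<in>- {j0}. monom 1 c dvd Q j) \<and> (c < n - a \<longrightarrow> (\<exists>j\<in>- {j0}. coeff (Q j) c \<noteq> 0))"
      by (rule exists_common_order)
    then obtain c where c: "c \<le> n - a" and dvdQ: "\<And>j. j \<noteq> j0 \<Longrightarrow> monom 1 c dvd Q j"
      and unitQ: "c < n - a \<Longrightarrow> \<exists>j. j \<noteq> j0 \<and> coeff (Q j) c \<noteq> 0"
      by auto
    define b where "b = a + c"
    have b: "a \<le> b" "b \<le> n" "b - a = c" "n - b = n - a - c"
      using c a by (auto simp: b_def)
    define M where "M j = poly_shift c (Q j)" for j
    have QM: "Q j = monom 1 c * M j" if "j \<noteq> j0" for j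
      unfolding M_def using monom_mult_poly_shift[OF dvdQ[OF that]] by simp
    have e1: "monom 1 (n - a) dvd Y i1 j - L j * Y i1 j0 - monom 1 c * M j" if "j \<noteq> j0" for j
      unfolding QM[OF that, symmetric] Q_def by (rule trunc_dvd)
    define p where "p i j = (if j = j0 then Y i j0 else if i = i0 then L j else M j)" for i j
    define t where "t = (\<lambda>((i, j), m). coeff (p i j) m)"
    have P: "param_poly n a b i0 j0 t i j = p i j" for i j
      unfolding t_def
    proof (rule param_poly_coeff)
      fix m assume m: "param_bound n a b i0 j0 i j \<le> m"
      show "coeff (p i j) m = 0"
        using m degY[of m] c
        by (auto simp: p_def param_bound_def L_def M_def Q_def coeff_trunc coeff_poly_shift b split: if_splits)
    qed
    \<comment> \<open>The common factor \<open>z^a\<close> makes congruence modulo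
      \<open>z^(n-a)\<close> sufficient.\<close>
    have lift: "trunc n (monom 1 a * q) = X i j" if "monom 1 (n - a) dvd q - Y i j" for q i j
    proof (rule trunc_eqI[OF cutX])
      have "monom 1 n dvd monom 1 a * (q - Y i j)"
        using that by (simp only: monom_dvd_monom_mult_iff[OF a])
      then show "monom 1 n dvd monom 1 a * q - X i j"
        by (simp add: XY right_diff_distrib)
    qed
    have "x = param_hom n a b i0 j0 t"
    proof (rule hom_current_eqI[OF x param_hom_in])
      fix i j
      consider "j = j0" | "j \<noteq> j0" "i = i0" | "j \<noteq> j0" "i = i1"
        using i_cases by blast
      then have "monom 1 (n - a) dvd (if j = j0 then p i j else p i0 j * p i j0 +
          (if i = i0 then 0 else monom 1 (b - a) * p i j)) - Y i j"
      proof cases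
        case 1
        then show ?thesis by (simp add: p_def)
      next
        case 2
        then show ?thesis
          using e0[of j] dvd_diff_commute[of _ "Y i0 j"] by (simp add: p_def u_def)
      next
        case 3
        then have "monom 1 (n - a) dvd - (Y i1 j - L j * Y i1 j0 - monom 1 c * M j)"
          using e1[OF 3(1)] by (simp only: dvd_minus_iff)
        then show ?thesis
          using 3 i01 by (simp add: p_def b algebra_simps)
      qed
      then show "entry x i j = entry (param_hom n a b i0 j0 t) i j"
        unfolding param_hom_def P entry_hom_of by (subst lift) (simp_all add: X_def)
    qed
    moreover have "scale_mat.dim W \<le> 2 * a + b"
    proof (rule dim_le_torsion[OF i01 W, of "\<lambda>i. Y i j0"])
      show "coeff (Y i0 j0) 0 \<noteq> 0"
        using u by (simp add: u_def)
      fix A assume A: "A \<in> W"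
      have ann: "monom 1 (n - a) dvd A $ i $ i0 * Y i0 j + A $ i $ i1 * Y i1 j" for i j
      proof -
        have "monom 1 n dvd A $ i $ i0 * X i0 j + A $ i $ i1 * X i1 j"
          using annihilator_dvd_distinct[OF _ i01] A unfolding W_def X_def by blast
        also have "A $ i $ i0 * X i0 j + A $ i $ i1 * X i1 j =
            monom 1 a * (A $ i $ i0 * Y i0 j + A $ i $ i1 * Y i1 j)"
          by (simp add: XY algebra_simps)
        finally show ?thesis
          by (simp only: monom_dvd_monom_mult_iff[OF a])
      qed
      show "monom 1 n dvd monom 1 a * (A $ i $ i0 * Y i0 j0 + A $ i $ i1 * Y i1 j0)" for i
        unfolding monom_dvd_monom_mult_iff[OF a] by (rule ann)
      show "monom 1 n dvd monom 1 b * A $ i0 $ i1"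
      proof (cases "c < n - a")
        case False
        then show ?thesis using c a by (simp add: b_def)
      next
        case True
        then obtain j where j: "j \<noteq> j0" "coeff (Q j) c \<noteq> 0"
          using unitQ by blast
        have M0: "coeff (M j) 0 \<noteq> 0"
          using j(2) by (simp add: M_def coeff_poly_shift)
        let ?D = "monom 1 (n - a) :: complex poly"
        \<comment> \<open>Subtracting \<open>L j\<close> times the annihilator equation of column
          \<open>j0\<close> from that of column \<open>j\<close> leaves, modulo
          \<open>z^(n-a)\<close>, only the remainder of column \<open>j\<close>, whose factor
          \<open>M j\<close> is a unit.\<close>
        have "M j * (monom 1 c * A $ i0 $ i1) =
            (A $ i0 $ i0 * Y i0 j + A $ i0 $ i1 * Y i1 j) -
            L j * (A $ i0 $ i0 * Y i0 j0 + A $ i0 $ i1 * Y i1 j0) -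
            A $ i0 $ i0 * (Y i0 j - L j * u) -
            A $ i0 $ i1 * (Y i1 j - L j * Y i1 j0 - monom 1 c * M j)"
          by (simp add: u_def algebra_simps)
        also have "?D dvd \<dots>"
          by (intro dvd_diff dvd_mult ann e0 e1 j(1))
        finally have "?D dvd monom 1 c * A $ i0 $ i1"
          by (rule monom_dvd_unit_multD[OF M0])
        then have "monom 1 n dvd monom 1 a * (monom 1 c * A $ i0 $ i1)"
          unfolding monom_dvd_monom_mult_iff[OF a] .
        then show ?thesis
          by (simp add: b_def mult_monom mult.assoc[symmetric])
      qed
    qed (use a b in auto)
    ultimately show ?thesis
      using a b unfolding W_def by blast
  qed
qed

section \<open>Dimensions of the strata and the modality\<close>

lemma krull_dim_annihilator_stratum_le:
  fixes k :: nat
  assumes r: "CARD('r::finite) \<ge> 2"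
  shows "krull_dim (subtopology (zariski_topology hom_scale (hom_current n :: (complex^'r \<Rightarrow> complex poly^2) set))
     (annihilator_stratum scale_mat (current_sl2 n) (hom_current n) (hom_act n) (int k)))
     \<le> ereal (real (2 * CARD('r) * n - k))"
proof (rule krull_dim_parametrized_le)
  let ?K = "{(a, b, i0 :: 2, j0 :: 'r). a \<le> n \<and> b \<le> n \<and> k \<le> 2 * a + b}"
  have "?K \<subseteq> {..n} \<times> {..n} \<times> UNIV"
    by auto
  then show "finite ?K"
    by (rule finite_subset) simp
  show "finite ((\<lambda>(a, b, i0, j0). param_index n a b i0 j0) \<kappa>)" for \<kappa> :: "nat \<times> nat \<times> 2 \<times> 'r"
    by (simp add: finite_param_index split: prod.split)
  show "card ((\<lambda>(a, b, i0, j0). param_index n a b i0 j0) \<kappa>) \<le> 2 * CARD('r) * n - k" if "\<kappa> \<in> ?K" for \<kappa>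
    using that card_param_index_le[OF r] by auto
  show "annihilator_stratum scale_mat (current_sl2 n) (hom_current n) (hom_act n) (int k)
      \<subseteq> (\<Union>\<kappa>\<in>?K. range ((\<lambda>(a, b, i0, j0). param_hom n a b i0 j0) \<kappa>))"
  proof
    fix x :: "complex^'r \<Rightarrow> complex poly^2"
    assume "x \<in> annihilator_stratum scale_mat (current_sl2 n) (hom_current n) (hom_act n) (int k)"
    then have x: "x \<in> hom_current n" and k: "scale_mat.dim (annihilator (current_sl2 n) (hom_act n) x) = k"
      by (auto simp: annihilator_stratum_def)
    obtain a b i0 j0 t where "a \<le> n" "b \<le> n" "x = param_hom n a b i0 j0 t" "k \<le> 2 * a + b"
      using exists_param_hom[OF x] unfolding k by blast
    then show "x \<in> (\<Union>\<kappa>\<in>?K. range ((\<lambda>(a, b, i0, j0). param_hom n a b i0 j0) \<kappa>))"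
      by (intro UN_I[of "(a, b, i0, j0)"]) auto
  qed
  show "poly_param ((\<lambda>(a, b, i0, j0). param_index n a b i0 j0) \<kappa>)
      (\<lambda>t. f ((\<lambda>(a, b, i0, j0). param_hom n a b i0 j0) \<kappa> t))"
    if "poly_function_on hom_scale (hom_current n) f" for f and \<kappa> :: "nat \<times> nat \<times> 2 \<times> 'r"
    using poly_param_param_hom[OF that] by (simp split: prod.split)
qed

lemma annihilator_stratum_eq_empty:
  assumes "k < 0 \<or> k > 3 * int n"
  shows "annihilator_stratum scale_mat (current_sl2 n) (hom_current n :: (complex^'r::finite \<Rightarrow> complex poly^2) set)
     (hom_act n) k = {}"
proof (rule ccontr)
  assume "\<not> ?thesis"
  then obtain x :: "complex^'r \<Rightarrow> complex poly^2" where x: "x \<in> hom_current n"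
    and k: "k = int (scale_mat.dim (annihilator (current_sl2 n) (hom_act n) x))"
    by (auto simp: annihilator_stratum_def)
  obtain a b where "a \<le> n" "b \<le> n" "scale_mat.dim (annihilator (current_sl2 n) (hom_act n) x) \<le> 2 * a + b"
    using exists_param_hom[OF x] by blast
  then show False
    using assms k by linarith
qed

text \<open>Where the minor of two columns has nonzero constant term, it is a unit modulo
  \<open>z^n\<close>, and Cramer's rule forces every annihilating \<open>A\<close> to be zero. The
  stratum thus contains a nonempty open set of the whole space of dimension \<open>2rn\<close>, with
  \<open>r = CARD('r)\<close>.\<close>

lemma krull_dim_annihilator_stratum_0_ge:
  assumes r: "CARD('r::finite) \<ge> 2" and n: "n \<ge> 1"
  shows "ereal (real (2 * CARD('r) * n)) \<le>
     krull_dim (subtopology (zariski_topology hom_scale (hom_current n :: (complex^'r \<Rightarrow> complex poly^2) set))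
     (annihilator_stratum scale_mat (current_sl2 n) (hom_current n) (hom_act n) 0))"
proof -
  have "\<exists>j0 j1 :: 'r. j0 \<noteq> j1"
  proof (rule ccontr)
    assume "\<not> ?thesis"
    then have "(UNIV :: 'r set) = {undefined}" by auto
    then have "CARD('r) = card {undefined :: 'r}" by (rule arg_cong)
    then show False using r by simp
  qed
  then obtain j0 j1 :: 'r where j: "j0 \<noteq> j1" by blast
  define c where "c i j x = coeff (entry x i j) 0" for i j and x :: "complex^'r \<Rightarrow> complex poly^2"
  \<comment> \<open>The constant term of the minor; the difference is written with a factor
    \<open>- 1\<close> to match the generators of \<open>poly_function_on\<close>.\<close>
  define h where "h x = c 1 j0 x * c 2 j1 x + (- 1) * (c 1 j1 x * c 2 j0 x)" for x
  have h: "poly_function_on hom_scale (hom_current n) h"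
    unfolding h_def c_def
    by (intro poly_function_on.add poly_function_on.mult poly_function_on.const
        poly_function_on.linear linear_functional_on_entry)
  define p :: "complex^'r \<Rightarrow> complex poly^2"
    where "p = hom_of (\<lambda>i j. if i = 1 \<and> j = j0 \<or> i = 2 \<and> j = j1 then 1 else 0)"
  \<comment> \<open>The columns \<open>j0\<close> and \<open>j1\<close> of \<open>p\<close> form the
    identity matrix; its entry \<open>1\<close> is a remainder modulo \<open>z^n\<close> because
    \<open>n\<close> is positive.\<close>
  have p: "p \<in> hom_current n"
    unfolding p_def using n by (intro hom_of_in) (auto simp: trunc_eq_self_iff)
  have hp: "h p \<noteq> 0"
    using j by (simp add: h_def c_def p_def)
  have "x \<in> annihilator_stratum scale_mat (current_sl2 n) (hom_current n) (hom_act n) 0"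
    if x: "x \<in> hom_current n" and hx: "h x \<noteq> 0" for x
  proof -
    define d where "d = entry x 1 j0 * entry x 2 j1 - entry x 1 j1 * entry x 2 j0"
    have d: "coeff d 0 \<noteq> 0"
      using hx by (simp add: h_def c_def d_def coeff_mult)
    have "A = 0" if A: "A \<in> annihilator (current_sl2 n) (hom_act n) x" for A
    proof -
      have "trunc n (A $ i $ k) = A $ i $ k" for i k
        using A by (auto simp: annihilator_def current_sl2_def trunc_mat_def vec_eq_iff)
      then have eq0: "A $ i $ k = 0" if "monom 1 n dvd A $ i $ k" for i k
        using that trunc_eq_0_iff[of n "A $ i $ k"] by simp
      have ann: "monom 1 n dvd A $ i $ 1 * entry x 1 j + A $ i $ 2 * entry x 2 j" for i j
        by (rule annihilator_dvd[OF A])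
      have "monom 1 n dvd entry x 2 j1 * (A $ i $ 1 * entry x 1 j0 + A $ i $ 2 * entry x 2 j0) -
          entry x 2 j0 * (A $ i $ 1 * entry x 1 j1 + A $ i $ 2 * entry x 2 j1)" for i
        by (intro dvd_diff dvd_mult ann)
      then have "monom 1 n dvd d * A $ i $ 1" for i
        by (simp add: d_def algebra_simps)
      then have "A $ i $ 1 = 0" for i
        using eq0 monom_dvd_unit_multD[OF d] by blast
      moreover have "monom 1 n dvd entry x 1 j0 * (A $ i $ 1 * entry x 1 j1 + A $ i $ 2 * entry x 2 j1) -
          entry x 1 j1 * (A $ i $ 1 * entry x 1 j0 + A $ i $ 2 * entry x 2 j0)" for i
        by (intro dvd_diff dvd_mult ann)
      then have "monom 1 n dvd d * A $ i $ 2" for i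
        by (simp add: d_def algebra_simps)
      then have "A $ i $ 2 = 0" for i
        using eq0 monom_dvd_unit_multD[OF d] by blast
      ultimately show ?thesis
        by (simp add: vec_eq_iff forall_2)
    qed
    then have "scale_mat.dim (annihilator (current_sl2 n) (hom_act n) x) \<le> card ({} :: (complex poly^2^2) set)"
      by (intro scale_mat.dim_le_card) auto
    then show ?thesis
      using x by (simp add: annihilator_stratum_def)
  qed
  from hom_current.krull_dim_ge_card[OF h p hp this]
  show ?thesis
    by (simp add: card_cartesian_product)
qed

theorem theorem3p6:
  fixes n :: nat
  assumes "CARD('r::finite) \<ge> 2" and "n \<ge> 1"
  shows "modality scale_mat (current_sl2 n)
           hom_scale (hom_current n :: (complex^'r \<Rightarrow> complex poly^2) set) (hom_act n)
         = ereal ((2 * real CARD('r) - 3) * real n)"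
proof -
  define F where "F k = krull_dim (subtopology
      (zariski_topology hom_scale (hom_current n :: (complex^'r \<Rightarrow> complex poly^2) set))
      (annihilator_stratum scale_mat (current_sl2 n) (hom_current n) (hom_act n) k))
       - ereal (real (scale_mat.dim (current_sl2 n))) + ereal (of_int k)" for k
  have empty: "F k = - \<infinity>" if "k < 0 \<or> k > 3 * int n" for k
    unfolding F_def annihilator_stratum_eq_empty[OF that] krull_dim_empty by simp
  have le: "F k \<le> ereal ((2 * real CARD('r) - 3) * real n)" for k
  proof (cases "k < 0 \<or> k > 3 * int n")
    case False
    define m where "m = nat k"
    have m: "k = int m" "m \<le> 3 * n"
      using False by (auto simp: m_def)
    have "3 * n \<le> 2 * CARD('r) * n"
      using assms(1) by (intro mult_right_mono) auto
    \<comment> \<open>Since \<open>m \<le> 3 * n \<le> 2 * CARD('r) * n\<close>, the natural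
      subtraction is not truncated.\<close>
    then have sub: "real (2 * CARD('r) * n - m) = 2 * real CARD('r) * real n - real m"
      by (subst of_nat_diff[OF order_trans[OF m(2)]]) simp_all
    have "F k \<le> ereal (real (2 * CARD('r) * n - m)) - ereal (real (3 * n)) + ereal (real m)"
      unfolding F_def m(1) dim_current_sl2
      using krull_dim_annihilator_stratum_le[OF assms(1), of n m]
      by (intro add_mono ereal_minus_mono) auto
    also have "\<dots> = ereal ((2 * real CARD('r) - 3) * real n)"
      unfolding sub by (simp add: algebra_simps)
    finally show ?thesis .
  qed (simp add: empty)
  \<comment> \<open>Only finitely many strata are nonempty, so \<open>Max\<close> is taken over a
    finite set.\<close>
  have "range F \<subseteq> F ` {0..3 * int n} \<union> {- \<infinity>}"
  proof
    fix y assume "y \<in> range F"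
    then obtain k where "y = F k" by blast
    then show "y \<in> F ` {0..3 * int n} \<union> {- \<infinity>}"
      using empty[of k] by (cases "k < 0 \<or> k > 3 * int n") auto
  qed
  then have fin: "finite (range F)"
    by (rule finite_subset) simp
  have "ereal ((2 * real CARD('r) - 3) * real n) = ereal (real (2 * CARD('r) * n)) - ereal (real (3 * n)) + ereal 0"
    by (simp add: algebra_simps)
  also have "\<dots> \<le> F 0"
    unfolding F_def dim_current_sl2
    using krull_dim_annihilator_stratum_0_ge[OF assms]
    by (intro add_mono ereal_minus_mono) auto
  finally have "F 0 = ereal ((2 * real CARD('r) - 3) * real n)"
    using le[of 0] by simp
  then have "Max (range F) = ereal ((2 * real CARD('r) - 3) * real n)"
    using le by (intro Max_eqI fin) (auto intro: range_eqI[of _ _ 0])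
  then show ?thesis
    unfolding modality_def F_def .
qed

end
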